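(* Let $1<p<\infty$, let $0<s<1$, and let $\Omega\subset\mathbb{R}^N$ be an open set. Then the continuous embedding $\mathcal{D}_0^{s,p}(\Omega)\hookrightarrow L^p(\Omega)$ holds if and only if the continuous embedding $\mathcal{D}_0^{s,p}(\Omega)\hookrightarrow L^q(\Omega)$ holds for some (hence for all) $q$ with $p<q<p_s^\ast$.
   Context: $C_0^\infty(\Omega)$ is the set of smooth functions with compact support in $\Omega$ (extended by $0$ to $\mathbb{R}^N$). $\mathcal{D}_0^{s,p}(\Omega)$ is the completion of $C_0^\infty(\Omega)$ with respect to the norm $[u]_{s,p}=\Big(\iint_{\mathbb{R}^{2N}}\frac{|u(x)-u(y)|^p}{|x-y|^{N+sp}}\,dx\,dy\Big)^{1/p}$. The critical exponent is $p_s^\ast=\frac{Np}{N-sp}$ if $sp<N$ and $p_s^\ast=\infty$ if $sp\ge N$. The (continuous) embedding $\mathcal{D}_0^{s,p}(\Omega)\hookrightarrow L^q(\Omega)$ is equivalent to the condition $\lambda_{p,q}^s(\Omega)>0$, where $$\lambda_{p,q}^s(\Omega)=\inf_{u\in C_0^\infty(\Omega)}\Big\{[u]_{s,p}^p\ :\ \int_\Omega|u|^q\,dx=1\Big\},$$ i.e. to the existence of a constant $c>0$ with $c\,\|u\|_{L^q(\Omega)}\le[u]_{s,p}$ for all $u\in C_0^\infty(\Omega)$. *)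

theory Defs
  imports "HOL-Analysis.Analysis" "HOL-Library.Extended_Real"
begin

primrec C_k :: "nat \<Rightarrow> ('a::euclidean_space \<Rightarrow> real) \<Rightarrow> bool" where
  "C_k 0 f \<longleftrightarrow> continuous_on UNIV f"
| "C_k (Suc k) f \<longleftrightarrow> (\<forall>x. f differentiable (at x)) \<and>
     (\<forall>v. C_k k (\<lambda>x. frechet_derivative f (at x) v))"

text \<open>Functions on \<open>\<Omega>\<close> with compact support are identified with their extension by zero,
  so a test function is defined on the whole space.\<close>

definition test_functions :: "'a::euclidean_space set \<Rightarrow> ('a \<Rightarrow> real) set" where
  "test_functions \<Omega> = {u. (\<forall>k. C_k k u) \<and>
     compact (closure {x. u x \<noteq> 0}) \<and> closure {x. u x \<noteq> 0} \<subseteq> \<Omega>}"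

text \<open>The seminorm \<open>[u]\<^sub>s\<^sub>,\<^sub>p\<close>. It is only ever applied to test functions, for which the
  double integral is finite when \<open>1 < p\<close> and \<open>0 < s < 1\<close>; on the diagonal the integrand is \<open>0\<close>.\<close>

definition gagliardo :: "real \<Rightarrow> real \<Rightarrow> ('a::euclidean_space \<Rightarrow> real) \<Rightarrow> real" where
  "gagliardo s p u =
     (\<integral>(x, y). \<bar>u x - u y\<bar> powr p / norm (x - y) powr (real DIM('a) + s * p) \<partial>lborel)
       powr (1 / p)"

text \<open>The completion of the test functions, built as Cauchy sequences modulo null sequences.
  The norm of a class is the common limit of the norms along its representatives.\<close>

definition cauchy_seqs :: "real \<Rightarrow> real \<Rightarrow> 'a::euclidean_space set \<Rightarrow> (nat \<Rightarrow> 'a \<Rightarrow> real) set" where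
  "cauchy_seqs s p \<Omega> = {U. (\<forall>n. U n \<in> test_functions \<Omega>) \<and>
     (\<forall>e>0. \<exists>M. \<forall>m\<ge>M. \<forall>n\<ge>M. gagliardo s p (\<lambda>x. U m x - U n x) < e)}"

definition null_rel ::
    "real \<Rightarrow> real \<Rightarrow> 'a::euclidean_space set \<Rightarrow> (nat \<Rightarrow> 'a \<Rightarrow> real) rel" where
  "null_rel s p \<Omega> = {(U, V). U \<in> cauchy_seqs s p \<Omega> \<and> V \<in> cauchy_seqs s p \<Omega> \<and>
     (\<lambda>n. gagliardo s p (\<lambda>x. U n x - V n x)) \<longlonglongrightarrow> 0}"

definition D0 :: "real \<Rightarrow> real \<Rightarrow> 'a::euclidean_space set \<Rightarrow> (nat \<Rightarrow> 'a \<Rightarrow> real) set set" where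
  "D0 s p \<Omega> = cauchy_seqs s p \<Omega> // null_rel s p \<Omega>"

definition D0_norm :: "real \<Rightarrow> real \<Rightarrow> (nat \<Rightarrow> 'a::euclidean_space \<Rightarrow> real) set \<Rightarrow> real" where
  "D0_norm s p X = (THE r. \<forall>U\<in>X. (\<lambda>n. gagliardo s p (U n)) \<longlonglongrightarrow> r)"

definition Lq_functions :: "real \<Rightarrow> 'a::euclidean_space set \<Rightarrow> ('a \<Rightarrow> real) set" where
  "Lq_functions q \<Omega> = {f \<in> borel_measurable (lebesgue_on \<Omega>).
     integrable (lebesgue_on \<Omega>) (\<lambda>x. \<bar>f x\<bar> powr q)}"

definition ae_rel :: "real \<Rightarrow> 'a::euclidean_space set \<Rightarrow> ('a \<Rightarrow> real) rel" where
  "ae_rel q \<Omega> = {(f, g). f \<in> Lq_functions q \<Omega> \<and> g \<in> Lq_functions q \<Omega> \<and>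
     (AE x in lebesgue_on \<Omega>. f x = g x)}"

definition Lq :: "real \<Rightarrow> 'a::euclidean_space set \<Rightarrow> ('a \<Rightarrow> real) set set" where
  "Lq q \<Omega> = Lq_functions q \<Omega> // ae_rel q \<Omega>"

definition Lq_norm :: "real \<Rightarrow> 'a::euclidean_space set \<Rightarrow> ('a \<Rightarrow> real) set \<Rightarrow> real" where
  "Lq_norm q \<Omega> F =
     (THE r. \<forall>f\<in>F. (\<integral>x. \<bar>f x\<bar> powr q \<partial>lebesgue_on \<Omega>) powr (1 / q) = r)"

text \<open>A continuous embedding is an injective bounded linear map between the two spaces of classes
  that restricts to the identity on test functions; the second conjunct is linearity, written
  through representatives, and a test function \<open>u\<close> sits in the completion as the class of the
  constant sequence \<open>u\<close>.\<close>

definition continuously_embedded ::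
    "real \<Rightarrow> real \<Rightarrow> real \<Rightarrow> 'a::euclidean_space set \<Rightarrow> bool" where
  "continuously_embedded s p q \<Omega> \<longleftrightarrow>
     (\<exists>J. J \<in> D0 s p \<Omega> \<rightarrow> Lq q \<Omega> \<and>
       (\<forall>U\<in>cauchy_seqs s p \<Omega>. \<forall>V\<in>cauchy_seqs s p \<Omega>.
          \<forall>f \<in> J (null_rel s p \<Omega> `` {U}). \<forall>g \<in> J (null_rel s p \<Omega> `` {V}). \<forall>a b.
            (\<lambda>x. a * f x + b * g x) \<in> J (null_rel s p \<Omega> `` {\<lambda>n x. a * U n x + b * V n x})) \<and>
       inj_on J (D0 s p \<Omega>) \<and>
       (\<exists>C. \<forall>X\<in>D0 s p \<Omega>. Lq_norm q \<Omega> (J X) \<le> C * D0_norm s p X) \<and>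
       (\<forall>u\<in>test_functions \<Omega>. J (null_rel s p \<Omega> `` {\<lambda>n. u}) = ae_rel q \<Omega> `` {u}))"

definition critical_exponent :: "nat \<Rightarrow> real \<Rightarrow> real \<Rightarrow> ereal" where
  "critical_exponent N s p =
     (if s * p < real N then ereal (real N * p / (real N - s * p)) else \<infinity>)"

end

theory Submission imports Defs begin

text \<open>
  Write \<open>N\<close> for the dimension, \<open>[u]\<close> for the Gagliardo seminorm and \<open>\<parallel>u\<parallel>\<^sub>q\<close> for the norm of
  \<open>L\<^sup>q\<close>. Everything rests on inequalities \<open>\<parallel>u\<parallel>\<^sub>q \<le> C [u]\<close> for test functions \<open>u\<close>
  (\<open>energy_bounds_Lp\<close>). Such an inequality is equivalent to the continuous embedding of the
  completion (\<open>continuously_embedded_iff_energy_bounds_Lp\<close>): completeness of \<open>L\<^sup>q\<close> extends the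
  identity on test functions to the completion, and the extension is injective because, by
  Fatou's lemma, a Cauchy sequence for the energy that tends to \<open>0\<close> in \<open>L\<^sup>q\<close> also tends to \<open>0\<close>
  in energy.

  From \<open>p\<close> to \<open>q\<close>. Let \<open>A\<close> be the integral of \<open>\<bar>u\<bar>\<^sup>a\<close> and let \<open>\<bar>u x\<bar> = t\<close>. By Markov's inequality
  \<open>\<bar>u\<bar> < t / 2\<close> on at least half of a ball around \<open>x\<close> of volume comparable to \<open>A / t\<^sup>a\<close>, and this
  half bounds the inner integral of the energy at \<open>x\<close> from below by a multiple of
  \<open>t\<^sup>b A\<^sup>-\<^sup>\<sigma>\<close>, where \<open>\<sigma> = s p / N\<close> and \<open>b = p + \<sigma> a\<close> (\<open>kernel_integral_lower_bound\<close>).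
  Integration in \<open>x\<close> yields an inequality of Gagliardo-Nirenberg type, by which a bound in \<open>L\<^sup>a\<close>
  gives one in \<open>L\<^sup>b\<close>. Iterating from \<open>a = p\<close> produces exponents that increase to the critical
  one (\<open>sobolev_exponents_exceed\<close>), and the exponents in between follow by interpolation.

  From \<open>q\<close> to \<open>p\<close>. Let \<open>\<eta>\<close> be a cutoff of width \<open>R\<close>, namely a rescaled translate of a fixed
  nonzero test function. The inequality for \<open>u \<eta>\<close>, weakened to \<open>L\<^sup>p\<close> on the support of \<open>\<eta>\<close>, costs
  a factor \<open>R powr (N (1 - p / q))\<close>, while the energy of the cutoff contributes \<open>R\<^sup>-\<^sup>s\<^sup>p\<close>. Averaging over
  all positions of \<open>\<eta>\<close> gives
  \<open>\<parallel>u\<parallel>\<^sub>p\<^sup>p \<le> K R powr (N (1 - p / q)) ([u]\<^sup>p + R\<^sup>-\<^sup>s\<^sup>p \<parallel>u\<parallel>\<^sub>p\<^sup>p)\<close> (\<open>localised_inequality\<close>). Subcriticality of \<open>q\<close>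
  means \<open>N (1 - p / q) < s p\<close>, so for a large fixed \<open>R\<close> the last term is absorbed on the left.
\<close>

section \<open>Test functions\<close>

lemma C_k_SucD: "C_k (Suc k) f \<Longrightarrow> C_k k f"
proof (induction k arbitrary: f)
  case 0
  then show ?case
    by (auto simp: continuous_on_eq_continuous_at intro: differentiable_imp_continuous_within)
next
  case (Suc k)
  then show ?case by (metis C_k.simps(2))
qed

text \<open>The predicate \<open>C_k\<close> fixes the derivative through \<open>frechet_derivative\<close>; this rule lets a
  candidate derivative be given in closed form instead.\<close>

lemma C_k_SucI:
  assumes "\<And>x. (f has_derivative (\<lambda>v. D v x)) (at x)" and "\<And>v. C_k k (D v)"
  shows "C_k (Suc k) f"
proof -
  have "frechet_derivative f (at x) v = D v x" for x v
    using frechet_derivative_at[OF assms(1)[of x]] by metis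
  then show ?thesis
    using assms by (auto simp: differentiable_def)
qed

lemma C_k_Suc_has_derivative:
  "C_k (Suc k) f \<Longrightarrow> (f has_derivative (\<lambda>v. frechet_derivative f (at x) v)) (at x)"
  using frechet_derivative_works by auto

lemma C_k_lincomb: "C_k k f \<Longrightarrow> C_k k g \<Longrightarrow> C_k k (\<lambda>x. a * f x + b * g x)"
proof (induction k arbitrary: f g)
  case 0
  then show ?case by (auto intro!: continuous_intros)
next
  case (Suc k)
  note d = Suc.prems[THEN C_k_Suc_has_derivative]
  show ?case
  proof (rule C_k_SucI)
    show "((\<lambda>x. a * f x + b * g x) has_derivative
      (\<lambda>v. a * frechet_derivative f (at x) v + b * frechet_derivative g (at x) v)) (at x)" for x
      by (intro derivative_intros d)
    show "C_k k (\<lambda>x. a * frechet_derivative f (at x) v + b * frechet_derivative g (at x) v)" for v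
      using Suc.prems by (intro Suc.IH) auto
  qed
qed

lemma C_k_mult: "C_k k f \<Longrightarrow> C_k k g \<Longrightarrow> C_k k (\<lambda>x. f x * g x)"
proof (induction k arbitrary: f g)
  case 0
  then show ?case by (auto intro!: continuous_intros)
next
  case (Suc k)
  note d = Suc.prems[THEN C_k_Suc_has_derivative]
  show ?case
  proof (rule C_k_SucI)
    show "((\<lambda>x. f x * g x) has_derivative
      (\<lambda>v. 1 * (f x * frechet_derivative g (at x) v) + 1 * (frechet_derivative f (at x) v * g x))) (at x)" for x
      using has_derivative_mult[OF d] by simp
    show "C_k k (\<lambda>x. 1 * (f x * frechet_derivative g (at x) v) +
        1 * (frechet_derivative f (at x) v * g x))" for v
      using Suc.prems C_k_SucD[OF Suc.prems(1)] C_k_SucD[OF Suc.prems(2)]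
      by (intro C_k_lincomb Suc.IH) auto
  qed
qed

lemma C_k_affine: "C_k k f \<Longrightarrow> C_k k (\<lambda>x. f (r *\<^sub>R x + c))"
proof (induction k arbitrary: f)
  case 0
  then have "continuous_on UNIV (f \<circ> (\<lambda>x. r *\<^sub>R x + c))"
    by (intro continuous_on_compose continuous_intros) (auto intro: continuous_on_subset)
  then show ?case by (simp add: o_def)
next
  case (Suc k)
  note d = Suc.prems[THEN C_k_Suc_has_derivative]
  show ?case
  proof (rule C_k_SucI)
    have "((\<lambda>x. r *\<^sub>R x + c) has_derivative (\<lambda>v. r *\<^sub>R v)) (at x)" for x :: 'a
      by (auto intro!: derivative_eq_intros)
    then show "((\<lambda>x. f (r *\<^sub>R x + c)) has_derivative
      (\<lambda>v. frechet_derivative f (at (r *\<^sub>R x + c)) (r *\<^sub>R v))) (at x)" for x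
      using diff_chain_at[OF _ d] by (auto simp: o_def)
    show "C_k k (\<lambda>x. frechet_derivative f (at (r *\<^sub>R x + c)) (r *\<^sub>R v))" for v
      using Suc.prems by (intro Suc.IH[of "\<lambda>y. frechet_derivative f (at y) (r *\<^sub>R v)"]) auto
  qed
qed

lemma test_functionsI:
  assumes "\<And>k. C_k k u" "compact K" "K \<subseteq> \<Omega>" "\<And>x. u x \<noteq> 0 \<Longrightarrow> x \<in> K"
  shows "u \<in> test_functions \<Omega>"
proof -
  have "closure {x. u x \<noteq> 0} \<subseteq> K"
    using assms by (intro closure_minimal compact_imp_closed) auto
  moreover from this have "compact (closure {x. u x \<noteq> 0})"
    using assms(2) compact_Int_closed[of K "closure {x. u x \<noteq> 0}"] by (simp add: Int_absorb1)
  ultimately show ?thesis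
    using assms by (auto simp: test_functions_def)
qed

lemma test_function_support:
  "u \<in> test_functions \<Omega> \<Longrightarrow> compact (closure {x. u x \<noteq> 0})"
  "u \<in> test_functions \<Omega> \<Longrightarrow> closure {x. u x \<noteq> 0} \<subseteq> \<Omega>"
  "u x \<noteq> 0 \<Longrightarrow> x \<in> closure {x. u x \<noteq> 0}"
  using closure_subset[of "{x. u x \<noteq> 0}"] by (auto simp: test_functions_def)

lemma test_function_eq_0: "u \<in> test_functions \<Omega> \<Longrightarrow> x \<notin> \<Omega> \<Longrightarrow> u x = 0"
  using test_function_support[of u] by blast

lemma test_functions_zero: "(\<lambda>x. 0) \<in> test_functions \<Omega>"
proof (rule test_functionsI[where K = "{}"])
  show "C_k k (\<lambda>x::'a. 0)" for k by (induction k) auto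
qed auto

lemma test_functions_lincomb:
  assumes "u \<in> test_functions \<Omega>" "v \<in> test_functions \<Omega>"
  shows "(\<lambda>x. a * u x + b * v x) \<in> test_functions \<Omega>"
  using assms
  by (intro test_functionsI[where K = "closure {x. u x \<noteq> 0} \<union> closure {x. v x \<noteq> 0}"] compact_Un)
     (auto simp: test_functions_def intro!: C_k_lincomb test_function_support(3))

lemma test_functions_diff:
  assumes "u \<in> test_functions \<Omega>" "v \<in> test_functions \<Omega>"
  shows "(\<lambda>x. u x - v x) \<in> test_functions \<Omega>"
  using test_functions_lincomb[OF assms, of 1 "-1"] by simp

text \<open>The cutoffs used to localise a test function are rescaled translates of another test function,
  so that no particular smooth bump has to be constructed.\<close>

lemma test_functions_mult_rescaled:
  assumes "u \<in> test_functions \<Omega>" "\<phi> \<in> test_functions \<Omega>'"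
  shows "(\<lambda>x. u x * \<phi> (r *\<^sub>R x + c)) \<in> test_functions \<Omega>"
  using assms
  by (intro test_functionsI[where K = "closure {x. u x \<noteq> 0}"] C_k_mult C_k_affine)
     (auto simp: test_functions_def intro!: test_function_support(3))

lemma test_function_continuous: "u \<in> test_functions \<Omega> \<Longrightarrow> continuous_on UNIV u"
  unfolding test_functions_def using C_k.simps(1) by blast

lemma test_function_borel[measurable_dest]:
  "u \<in> test_functions \<Omega> \<Longrightarrow> u \<in> borel_measurable borel"
  by (intro borel_measurable_continuous_onI test_function_continuous)

lemma continuous_compact_support_bounded:
  fixes f :: "'a::topological_space \<Rightarrow> real"
  assumes "continuous_on UNIV f" "compact K" "\<And>x. f x \<noteq> 0 \<Longrightarrow> x \<in> K"
  shows "\<exists>B>0. \<forall>x. \<bar>f x\<bar> \<le> B"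
proof -
  have "compact (f ` K)"
    using assms by (intro compact_continuous_image) (auto intro: continuous_on_subset)
  then obtain B where B: "B > 0" "\<And>x. x \<in> K \<Longrightarrow> \<bar>f x\<bar> \<le> B"
    using compact_imp_bounded[of "f ` K"] by (auto simp: bounded_pos)
  then have "\<bar>f x\<bar> \<le> B" for x
    using assms(3)[of x] by (cases "f x = 0") auto
  with B(1) show ?thesis by blast
qed

lemma test_function_bounded: "u \<in> test_functions \<Omega> \<Longrightarrow> \<exists>B>0. \<forall>x. \<bar>u x\<bar> \<le> B"
  by (rule continuous_compact_support_bounded[OF test_function_continuous test_function_support(1)])
     (auto intro: test_function_support(3))

lemma test_function_bounded_support:
  assumes "u \<in> test_functions \<Omega>"
  shows "\<exists>\<rho>>0. \<forall>x. u x \<noteq> 0 \<longrightarrow> norm x < \<rho>"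
proof -
  obtain \<rho> where "\<rho> > 0" "\<And>x. x \<in> closure {x. u x \<noteq> 0} \<Longrightarrow> norm x \<le> \<rho>"
    using compact_imp_bounded[OF test_function_support(1)[OF assms]] by (auto simp: bounded_pos)
  then show ?thesis
    using test_function_support(3)[of u] by (intro exI[of _ "\<rho> + 1"]) force
qed

text \<open>Each partial derivative is continuous and vanishes off the support, hence is bounded; together
  they bound the operator norm of the derivative.\<close>

lemma test_function_Lipschitz:
  fixes u :: "'a::euclidean_space \<Rightarrow> real"
  assumes u: "u \<in> test_functions \<Omega>"
  shows "\<exists>L>0. \<forall>x y. \<bar>u x - u y\<bar> \<le> L * norm (x - y)"
proof -
  define S where "S = closure {x. u x \<noteq> 0}"
  let ?D = "\<lambda>x. frechet_derivative u (at x)"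
  have C: "C_k (Suc 0) u"
    using u by (auto simp: test_functions_def)
  note d = C_k_Suc_has_derivative[OF C]
  have z: "?D x v = 0" if "x \<notin> S" for x v
  proof -
    have "((\<lambda>x. 0) has_derivative (?D x)) (at x)"
    proof (rule has_derivative_transform_within_open[OF d])
      show "open (- S)" "x \<in> - S" using that by (auto simp: S_def)
      show "u y = 0" if "y \<in> - S" for y
        using that test_function_support(3)[of u y] by (auto simp: S_def)
    qed
    then show ?thesis
      using has_derivative_unique[OF _ has_derivative_const] by metis
  qed
  have "\<exists>B>0. \<forall>x. \<bar>?D x v\<bar> \<le> B" for v
    using C z u by (intro continuous_compact_support_bounded[of _ S])
      (auto simp: S_def simp del: compact_closure intro: test_function_support(1))
  then obtain B where B: "\<And>v. B v > 0" "\<And>v x. \<bar>?D x v\<bar> \<le> B v" by metis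
  define L where "L = (\<Sum>b\<in>Basis. B (b::'a))"
  have "onorm (?D x) \<le> L" for x
  proof (rule onorm_bound)
    show "L \<ge> 0" unfolding L_def using B(1) by (intro sum_nonneg) (auto intro: less_imp_le)
    fix v
    have lin: "linear (?D x)" using d has_derivative_linear by blast
    have "?D x v = ?D x (\<Sum>b\<in>Basis. (v \<bullet> b) *\<^sub>R b)" by (simp add: euclidean_representation)
    also have "\<dots> = (\<Sum>b\<in>Basis. (v \<bullet> b) * ?D x b)"
      by (simp add: linear_sum[OF lin] linear_scale[OF lin])
    finally have "norm (?D x v) \<le> (\<Sum>b\<in>Basis. \<bar>v \<bullet> b\<bar> * \<bar>?D x b\<bar>)"
      using sum_abs[of "\<lambda>b. (v \<bullet> b) * ?D x b" Basis] by (simp add: abs_mult)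
    also have "\<dots> \<le> (\<Sum>b\<in>Basis. norm v * B b)"
      by (intro sum_mono mult_mono B(2) Basis_le_norm) auto
    finally show "norm (?D x v) \<le> L * norm v" by (simp add: L_def sum_distrib_left mult.commute)
  qed
  then have "norm (u x - u y) \<le> L * norm (x - y)" for x y
    using d by (intro differentiable_bound[where S = UNIV and f' = ?D]) auto
  moreover have "L > 0" unfolding L_def using B(1) by (intro sum_pos) auto
  ultimately show ?thesis by auto
qed

section \<open>The spaces of p-integrable functions\<close>

definition Lp_functions :: "'b measure \<Rightarrow> real \<Rightarrow> ('b \<Rightarrow> real) set" where
  "Lp_functions M q = {f \<in> borel_measurable M. integrable M (\<lambda>x. \<bar>f x\<bar> powr q)}"

definition Lp_seminorm :: "'b measure \<Rightarrow> real \<Rightarrow> ('b \<Rightarrow> real) \<Rightarrow> real" where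
  "Lp_seminorm M q f = (\<integral>x. \<bar>f x\<bar> powr q \<partial>M) powr (1 / q)"

lemma Lp_measurable[measurable_dest]: "f \<in> Lp_functions M q \<Longrightarrow> f \<in> borel_measurable M"
  by (simp add: Lp_functions_def)

lemma Lp_integrable: "f \<in> Lp_functions M q \<Longrightarrow> integrable M (\<lambda>x. \<bar>f x\<bar> powr q)"
  by (simp add: Lp_functions_def)

lemma Lp_seminorm_nonneg[simp]: "Lp_seminorm M q f \<ge> 0"
  by (simp add: Lp_seminorm_def)

lemma integral_eq_Lp_seminorm_powr:
  "q > 0 \<Longrightarrow> (\<integral>x. \<bar>f x\<bar> powr q \<partial>M) = Lp_seminorm M q f powr q"
  by (simp add: Lp_seminorm_def powr_powr)

lemma Lp_seminorm_le_iff: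
  "q > 0 \<Longrightarrow> e \<ge> 0 \<Longrightarrow> Lp_seminorm M q f \<le> e \<longleftrightarrow> (\<integral>x. \<bar>f x\<bar> powr q \<partial>M) \<le> e powr q"
  using powr_mono2[of q "Lp_seminorm M q f" e] powr_less_mono2[of q e "Lp_seminorm M q f"]
  by (auto simp: integral_eq_Lp_seminorm_powr not_le[symmetric])

lemma abs_add_powr_le:
  fixes a b :: real
  assumes "q \<ge> 0"
  shows "\<bar>a + b\<bar> powr q \<le> 2 powr q * (\<bar>a\<bar> powr q + \<bar>b\<bar> powr q)"
proof -
  have "\<bar>a + b\<bar> powr q \<le> (2 * max \<bar>a\<bar> \<bar>b\<bar>) powr q"
    using assms by (intro powr_mono2) auto
  also have "\<dots> = 2 powr q * max \<bar>a\<bar> \<bar>b\<bar> powr q" by (simp add: powr_mult)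
  also have "\<dots> \<le> 2 powr q * (\<bar>a\<bar> powr q + \<bar>b\<bar> powr q)"
    by (intro mult_left_mono) (auto simp: max_def)
  finally show ?thesis .
qed

lemma Lp_scale:
  assumes "f \<in> Lp_functions M q"
  shows "(\<lambda>x. a * f x) \<in> Lp_functions M q"
  using assms by (auto simp: Lp_functions_def abs_mult powr_mult)

lemma Lp_add:
  assumes "q \<ge> 0" "f \<in> Lp_functions M q" "g \<in> Lp_functions M q"
  shows "(\<lambda>x. f x + g x) \<in> Lp_functions M q"
proof -
  note [measurable] = assms(2,3)
  have "integrable M (\<lambda>x. \<bar>f x + g x\<bar> powr q)"
  proof (rule Bochner_Integration.integrable_bound)
    show "integrable M (\<lambda>x. 2 powr q * (\<bar>f x\<bar> powr q + \<bar>g x\<bar> powr q))"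
      using assms by (auto simp: Lp_functions_def)
    show "AE x in M. norm (\<bar>f x + g x\<bar> powr q) \<le> norm (2 powr q * (\<bar>f x\<bar> powr q + \<bar>g x\<bar> powr q))"
      using abs_add_powr_le[OF assms(1)] by (intro AE_I2) auto
  qed simp
  then show ?thesis by (simp add: Lp_functions_def)
qed

lemma Lp_lincomb:
  assumes "q \<ge> 0" "f \<in> Lp_functions M q" "g \<in> Lp_functions M q"
  shows "(\<lambda>x. a * f x + b * g x) \<in> Lp_functions M q"
  by (intro Lp_add Lp_scale assms)

lemma Lp_diff:
  assumes "q \<ge> 0" "f \<in> Lp_functions M q" "g \<in> Lp_functions M q"
  shows "(\<lambda>x. f x - g x) \<in> Lp_functions M q"
  using Lp_lincomb[OF assms, of 1 "-1"] by simp

lemma Lp_seminorm_scale: "q > 0 \<Longrightarrow> Lp_seminorm M q (\<lambda>x. a * f x) = \<bar>a\<bar> * Lp_seminorm M q f"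
  by (simp add: Lp_seminorm_def abs_mult powr_mult powr_powr)

lemma Lp_seminorm_minus_commute:
  "Lp_seminorm M q (\<lambda>x. f x - g x) = Lp_seminorm M q (\<lambda>x. g x - f x)"
  by (simp add: Lp_seminorm_def abs_minus_commute)

lemma powr_convex_comb:
  fixes x y :: real
  assumes "q \<ge> 1" "0 \<le> t" "t \<le> 1" "0 \<le> x" "0 \<le> y"
  shows "((1 - t) * x + t * y) powr q \<le> (1 - t) * x powr q + t * y powr q"
proof -
  have *: "(r * z) powr q \<le> r * z powr q" if "0 \<le> r" "r \<le> 1" for r z :: real
  proof -
    have "r powr q \<le> r powr 1"
      using that assms(1) by (intro powr_mono') auto
    then show ?thesis using that by (auto simp: powr_mult intro!: mult_right_mono)
  qed
  consider "x = 0" | "y = 0" | "x > 0" "y > 0" using assms by linarith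
  then show ?thesis
  proof cases
    case 3
    then show ?thesis
      using convex_onD[OF powr_convex[OF assms(1)], of t x y] assms by auto
  qed (use * assms in auto)
qed

text \<open>Minkowski's inequality: after division by the two norms it is the convexity of
  \<open>t \<mapsto> t powr q\<close>. Positive upper bounds of the norms in place of the norms themselves
  avoid a division by zero.\<close>

lemma Lp_seminorm_triangle:
  assumes q: "q \<ge> 1" and f: "f \<in> Lp_functions M q" and g: "g \<in> Lp_functions M q"
  shows "Lp_seminorm M q (\<lambda>x. f x + g x) \<le> Lp_seminorm M q f + Lp_seminorm M q g"
proof -
  note [measurable] = f g
  have *: "Lp_seminorm M q (\<lambda>x. f x + g x) \<le> A + B"
    if A: "A > 0" "Lp_seminorm M q f \<le> A" and B: "B > 0" "Lp_seminorm M q g \<le> B" for A B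
  proof -
    define t where "t = B / (A + B)"
    have t: "0 \<le> t" "t \<le> 1" "1 - t = A / (A + B)" using A B by (auto simp: t_def field_simps)
    let ?h = "\<lambda>x. (A + B) powr q * ((1 - t) * (\<bar>f x\<bar> powr q / A powr q) + t * (\<bar>g x\<bar> powr q / B powr q))"
    have le: "\<bar>f x + g x\<bar> powr q \<le> ?h x" for x
    proof -
      have "(1 - t) * (\<bar>f x\<bar> / A) = \<bar>f x\<bar> / (A + B)" "t * (\<bar>g x\<bar> / B) = \<bar>g x\<bar> / (A + B)"
        using A B unfolding t(3) by (auto simp: t_def)
      then have eq: "\<bar>f x\<bar> + \<bar>g x\<bar> = (A + B) * ((1 - t) * (\<bar>f x\<bar> / A) + t * (\<bar>g x\<bar> / B))"
        using A B by (simp add: add_divide_distrib[symmetric])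
      have "\<bar>f x + g x\<bar> powr q \<le> (\<bar>f x\<bar> + \<bar>g x\<bar>) powr q"
        using q by (intro powr_mono2) auto
      also have "\<dots> = (A + B) powr q * ((1 - t) * (\<bar>f x\<bar> / A) + t * (\<bar>g x\<bar> / B)) powr q"
        unfolding eq using t A B by (intro powr_mult)
      also have "\<dots> \<le> (A + B) powr q * ((1 - t) * (\<bar>f x\<bar> / A) powr q + t * (\<bar>g x\<bar> / B) powr q)"
        using q t A B by (intro mult_left_mono powr_convex_comb) auto
      also have "\<dots> = ?h x" using A B by (simp add: powr_divide)
      finally show ?thesis .
    qed
    have "(\<integral>x. \<bar>f x + g x\<bar> powr q \<partial>M) \<le> (\<integral>x. ?h x \<partial>M)"
      using q f g Lp_add[of q f M g] le by (intro integral_mono) (auto simp: Lp_functions_def)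
    also have "\<dots> = (A + B) powr q *
        ((1 - t) * ((\<integral>x. \<bar>f x\<bar> powr q \<partial>M) / A powr q) + t * ((\<integral>x. \<bar>g x\<bar> powr q \<partial>M) / B powr q))"
      using f g by (simp add: Lp_functions_def)
    also have "\<dots> \<le> (A + B) powr q * ((1 - t) * 1 + t * 1)"
      using A B q t
      by (intro mult_left_mono add_mono) (auto simp: Lp_seminorm_le_iff[symmetric])
    finally show ?thesis
      using A B q by (subst Lp_seminorm_le_iff) auto
  qed
  show ?thesis
  proof (rule field_le_epsilon)
    fix e :: real assume "e > 0"
    then show "Lp_seminorm M q (\<lambda>x. f x + g x) \<le> Lp_seminorm M q f + Lp_seminorm M q g + e"
      using *[of "Lp_seminorm M q f + e/2" "Lp_seminorm M q g + e/2"]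
      by (auto simp: add_nonneg_pos)
  qed
qed

lemma Lp_seminorm_triangle_diff:
  assumes q: "q \<ge> 1" and "f \<in> Lp_functions M q" "g \<in> Lp_functions M q" "h \<in> Lp_functions M q"
  shows "Lp_seminorm M q (\<lambda>x. f x - h x)
    \<le> Lp_seminorm M q (\<lambda>x. f x - g x) + Lp_seminorm M q (\<lambda>x. g x - h x)"
  using Lp_seminorm_triangle[OF q Lp_diff[of q f M g] Lp_diff[of q g M h]] assms by simp

lemma Lp_seminorm_reverse_triangle:
  assumes q: "q \<ge> 1" and "f \<in> Lp_functions M q" "g \<in> Lp_functions M q"
  shows "\<bar>Lp_seminorm M q f - Lp_seminorm M q g\<bar> \<le> Lp_seminorm M q (\<lambda>x. f x - g x)"
proof -
  have "Lp_seminorm M q f \<le> Lp_seminorm M q (\<lambda>x. f x - g x) + Lp_seminorm M q g"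
    using Lp_seminorm_triangle[OF q Lp_diff[of q f M g], of g] assms by simp
  moreover have "Lp_seminorm M q g \<le> Lp_seminorm M q (\<lambda>x. f x - g x) + Lp_seminorm M q f"
    using Lp_seminorm_triangle[OF q Lp_diff[of q g M f], of f] assms
    by (simp add: Lp_seminorm_minus_commute[of M q g])
  ultimately show ?thesis by linarith
qed

lemma Lp_seminorm_eq_0_iff:
  assumes "f \<in> Lp_functions M q" "q > 0"
  shows "Lp_seminorm M q f = 0 \<longleftrightarrow> (AE x in M. f x = 0)"
  using assms integral_nonneg_eq_0_iff_AE[of M "\<lambda>x. \<bar>f x\<bar> powr q"]
  by (auto simp: Lp_seminorm_def Lp_functions_def)

lemma Lp_seminorm_cong_AE:
  assumes "f \<in> Lp_functions M q" "g \<in> Lp_functions M q" "AE x in M. f x = g x"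
  shows "Lp_seminorm M q f = Lp_seminorm M q g"
  unfolding Lp_seminorm_def using assms
  by (intro arg_cong[where f = "\<lambda>x. x powr (1/q)"] integral_cong_AE) auto

text \<open>Fatou's lemma, in the form in which it turns a Cauchy estimate into an estimate for the
  limit.\<close>

lemma Lp_Cauchy_Fatou:
  fixes r :: "nat \<Rightarrow> nat"
  assumes q: "q \<ge> 1" and F: "\<And>n. F n \<in> Lp_functions M q"
    and f[measurable]: "f \<in> borel_measurable M"
    and r: "strict_mono r" and lim: "AE x in M. (\<lambda>k. F (r k) x) \<longlonglongrightarrow> f x"
    and C: "\<And>m n. m \<ge> N \<Longrightarrow> n \<ge> N \<Longrightarrow> Lp_seminorm M q (\<lambda>x. F m x - F n x) \<le> e"
    and e: "e \<ge> 0" and n: "n \<ge> N"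
  shows "(\<lambda>x. F n x - f x) \<in> Lp_functions M q \<and> Lp_seminorm M q (\<lambda>x. F n x - f x) \<le> e"
proof -
  note [measurable] = F
  have le: "(\<integral>\<^sup>+x. ennreal (\<bar>F n x - F (r k) x\<bar> powr q) \<partial>M) \<le> ennreal (e powr q)" if "k \<ge> N" for k
  proof -
    have "r k \<ge> N" using that seq_suble[OF r, of k] by linarith
    then have "(\<integral>x. \<bar>F n x - F (r k) x\<bar> powr q \<partial>M) \<le> e powr q"
      using C[of n "r k"] n q e by (simp add: Lp_seminorm_le_iff)
    moreover have "integrable M (\<lambda>x. \<bar>F n x - F (r k) x\<bar> powr q)"
      using q F by (intro Lp_integrable Lp_diff) auto
    ultimately show ?thesis
      by (subst nn_integral_eq_integral) (auto intro: ennreal_leI)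
  qed
  have "(\<integral>\<^sup>+x. ennreal (\<bar>F n x - f x\<bar> powr q) \<partial>M)
      \<le> (\<integral>\<^sup>+x. liminf (\<lambda>k. ennreal (\<bar>F n x - F (r k) x\<bar> powr q)) \<partial>M)"
  proof (rule nn_integral_mono_AE)
    show "AE x in M. ennreal (\<bar>F n x - f x\<bar> powr q) \<le> liminf (\<lambda>k. ennreal (\<bar>F n x - F (r k) x\<bar> powr q))"
      using lim
    proof eventually_elim
      case (elim x)
      have "(\<lambda>k. ennreal (\<bar>F n x - F (r k) x\<bar> powr q)) \<longlonglongrightarrow> ennreal (\<bar>F n x - f x\<bar> powr q)"
        using elim q by (intro tendsto_ennrealI tendsto_powr' tendsto_rabs tendsto_diff) auto
      then show ?case
        using lim_imp_Liminf[of sequentially] by fastforce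
    qed
  qed
  also have "\<dots> \<le> liminf (\<lambda>k. \<integral>\<^sup>+x. ennreal (\<bar>F n x - F (r k) x\<bar> powr q) \<partial>M)"
    by (intro nn_integral_liminf) measurable
  also have "\<dots> \<le> limsup (\<lambda>k. \<integral>\<^sup>+x. ennreal (\<bar>F n x - F (r k) x\<bar> powr q) \<partial>M)"
    by (intro Liminf_le_Limsup) simp
  also have "\<dots> \<le> ennreal (e powr q)"
    by (intro Limsup_bounded eventually_mono[OF eventually_ge_at_top[of N]] le)
  finally have *: "(\<integral>\<^sup>+x. ennreal (\<bar>F n x - f x\<bar> powr q) \<partial>M) \<le> ennreal (e powr q)" .
  then have "integrable M (\<lambda>x. \<bar>F n x - f x\<bar> powr q)"
    by (intro integrableI_nonneg) (auto intro: le_less_trans)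
  moreover from this have "(\<integral>x. \<bar>F n x - f x\<bar> powr q \<partial>M) \<le> e powr q"
    using * by (subst (asm) nn_integral_eq_integral) auto
  ultimately show ?thesis
    using q e by (simp add: Lp_functions_def Lp_seminorm_le_iff)
qed

text \<open>Completeness. A subsequence with \<open>\<parallel>F\<^sub>k\<^sub>+\<^sub>1 - F\<^sub>k\<parallel> < 4\<^sup>-\<^sup>k\<close> converges almost everywhere, because
  \<open>\<Sum> (2\<^sup>k \<bar>F\<^sub>k\<^sub>+\<^sub>1 - F\<^sub>k\<bar>)\<^sup>q\<close> is integrable, hence finite almost everywhere, so that the
  increments are eventually at most \<open>2\<^sup>-\<^sup>k\<close>. Convergence in norm of the whole sequence is then
  the preceding consequence of Fatou's lemma.\<close>

lemma Riesz_Fischer: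
  assumes q: "q \<ge> 1" and F: "\<And>n. F n \<in> Lp_functions M q"
    and C: "\<And>e. e > 0 \<Longrightarrow> \<exists>N. \<forall>m\<ge>N. \<forall>n\<ge>N. Lp_seminorm M q (\<lambda>x. F m x - F n x) < e"
  obtains f r where "f \<in> Lp_functions M q" "strict_mono r"
    "AE x in M. (\<lambda>k. F (r k) x) \<longlonglongrightarrow> f x"
    "(\<lambda>n. Lp_seminorm M q (\<lambda>x. F n x - f x)) \<longlonglongrightarrow> 0"
proof -
  note [measurable] = F
  have "\<exists>r. \<forall>k. (\<forall>m\<ge>r k. \<forall>n\<ge>r k. Lp_seminorm M q (\<lambda>x. F m x - F n x) < (1/4)^k) \<and> r k < r (Suc k)"
  proof (rule dependent_nat_choice)
    show "\<exists>N. \<forall>m\<ge>N. \<forall>n\<ge>N. Lp_seminorm M q (\<lambda>x. F m x - F n x) < (1/4)^0"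
      using C[of 1] by simp
    show "\<exists>N. (\<forall>m\<ge>N. \<forall>n\<ge>N. Lp_seminorm M q (\<lambda>x. F m x - F n x) < (1/4)^Suc k) \<and> i < N" for i k
    proof -
      obtain N where "\<forall>m\<ge>N. \<forall>n\<ge>N. Lp_seminorm M q (\<lambda>x. F m x - F n x) < (1/4)^Suc k"
        using C[of "(1/4)^Suc k"] by auto
      then show ?thesis by (intro exI[of _ "max N (Suc i)"]) auto
    qed
  qed
  then obtain r where r: "\<And>k m n. m \<ge> r k \<Longrightarrow> n \<ge> r k \<Longrightarrow> Lp_seminorm M q (\<lambda>x. F m x - F n x) < (1/4)^k"
    and mono: "strict_mono r"
    by (auto simp: strict_mono_Suc_iff)
  define d where "d = (\<lambda>k x. \<bar>F (r (Suc k)) x - F (r k) x\<bar>)"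
  have [measurable]: "d k \<in> borel_measurable M" for k unfolding d_def by measurable
  have int: "(\<integral>\<^sup>+x. ennreal ((2^k * d k x) powr q) \<partial>M) \<le> ennreal ((1/2)^k)" for k
  proof -
    have I: "(\<lambda>x. 2^k * (F (r (Suc k)) x - F (r k) x)) \<in> Lp_functions M q"
      using q F by (intro Lp_scale Lp_diff) auto
    have "Lp_seminorm M q (\<lambda>x. 2^k * (F (r (Suc k)) x - F (r k) x)) \<le> 2^k * (1/4)^k"
      using r[of k "r (Suc k)" "r k"] mono q
      by (subst Lp_seminorm_scale) (auto simp: strict_mono_less_eq intro!: mult_left_mono less_imp_le)
    also have "\<dots> = (1/2)^k" by (simp add: power_mult_distrib[symmetric])
    finally have "(\<integral>x. \<bar>2^k * (F (r (Suc k)) x - F (r k) x)\<bar> powr q \<partial>M) \<le> ((1/2)^k) powr q"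
      using q by (subst (asm) Lp_seminorm_le_iff) auto
    also have "\<dots> \<le> ((1/2)^k) powr 1"
      using q by (intro powr_mono') (auto simp: power_le_one)
    finally have "(\<integral>x. (2^k * d k x) powr q \<partial>M) \<le> (1/2)^k"
      by (simp add: d_def abs_mult)
    moreover have "integrable M (\<lambda>x. (2^k * d k x) powr q)"
      using Lp_integrable[OF I] by (simp add: d_def abs_mult)
    ultimately show ?thesis
      by (subst nn_integral_eq_integral) (auto intro!: ennreal_leI simp: d_def)
  qed
  have "(\<integral>\<^sup>+x. (\<Sum>k. ennreal ((2^k * d k x) powr q)) \<partial>M)
      = (\<Sum>k. \<integral>\<^sup>+x. ennreal ((2^k * d k x) powr q) \<partial>M)"
    by (intro nn_integral_suminf) measurable
  also have "\<dots> \<le> (\<Sum>k. ennreal ((1/2)^k))"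
    by (intro suminf_le int) auto
  also have "\<dots> < \<infinity>"
    by (subst suminf_ennreal2) (auto intro!: summable_geometric)
  finally have "AE x in M. (\<Sum>k. ennreal ((2^k * d k x) powr q)) \<noteq> \<infinity>"
    by (intro nn_integral_noteq_infinite) auto
  then have "AE x in M. convergent (\<lambda>k. F (r k) x)"
  proof eventually_elim
    case (elim x)
    have "summable (\<lambda>k. (2^k * d k x) powr q)"
      using elim by (intro summable_suminf_not_top) auto
    then have "(\<lambda>k. (2^k * d k x) powr q) \<longlonglongrightarrow> 0" by (rule summable_LIMSEQ_zero)
    then have "\<forall>\<^sub>F k in sequentially. (2^k * d k x) powr q < 1"
      by (rule order_tendstoD) simp
    then have "\<forall>\<^sub>F k in sequentially. norm (F (r (Suc k)) x - F (r k) x) \<le> (1/2)^k"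
    proof eventually_elim
      case (elim k)
      have "2^k * d k x \<le> 1"
      proof (rule ccontr)
        assume "\<not> ?thesis"
        then have "1 \<le> (2^k * d k x) powr q" using q by (intro ge_one_powr_ge_zero) auto
        with elim show False by simp
      qed
      then show ?case by (simp add: d_def field_simps)
    qed
    then have "summable (\<lambda>k. F (r (Suc k)) x - F (r k) x)"
      by (rule summable_comparison_test_ev) (auto intro!: summable_geometric)
    then have "convergent (\<lambda>k. F (r k) x - F (r 0) x)"
      by (simp add: summable_iff_convergent sum_lessThan_telescope[of "\<lambda>k. F (r k) x"])
    from convergent_add[OF this convergent_const[of "F (r 0) x"]] show ?case by simp
  qed
  then have lim: "AE x in M. (\<lambda>k. F (r k) x) \<longlonglongrightarrow> lim (\<lambda>k. F (r k) x)"
    by (simp add: convergent_LIMSEQ_iff)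
  define f where "f = (\<lambda>x. lim (\<lambda>k. F (r k) x))"
  have [measurable]: "f \<in> borel_measurable M" unfolding f_def by measurable
  have lim: "AE x in M. (\<lambda>k. F (r k) x) \<longlonglongrightarrow> f x" using lim by (simp add: f_def)
  have ev: "\<exists>N. \<forall>n\<ge>N. (\<lambda>x. F n x - f x) \<in> Lp_functions M q \<and> Lp_seminorm M q (\<lambda>x. F n x - f x) \<le> e"
    if e: "e > 0" for e
  proof -
    obtain N where "\<forall>m\<ge>N. \<forall>n\<ge>N. Lp_seminorm M q (\<lambda>x. F m x - F n x) < e" using C[OF e] by auto
    then show ?thesis
      using e by (intro exI[of _ N] allI impI Lp_Cauchy_Fatou[OF q F _ mono lim]) (auto intro: less_imp_le)
  qed
  show thesis
  proof (rule that[OF _ mono lim])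
    obtain N where "(\<lambda>x. F N x - f x) \<in> Lp_functions M q" using ev[of 1] by auto
    from Lp_diff[OF _ F[of N] this] q show "f \<in> Lp_functions M q" by simp
    show "(\<lambda>n. Lp_seminorm M q (\<lambda>x. F n x - f x)) \<longlonglongrightarrow> 0"
    proof (rule LIMSEQ_I)
      fix e :: real assume "e > 0"
      then show "\<exists>N. \<forall>n\<ge>N. norm (Lp_seminorm M q (\<lambda>x. F n x - f x) - 0) < e"
        using ev[of "e/2"] by force
    qed
  qed
qed

section \<open>The Gagliardo energy\<close>

definition gagliardo_kernel :: "real \<Rightarrow> real \<Rightarrow> ('a::euclidean_space \<Rightarrow> real) \<Rightarrow> 'a \<Rightarrow> 'a \<Rightarrow> real" where
  "gagliardo_kernel s p u x y = \<bar>u x - u y\<bar> powr p / norm (x - y) powr (real DIM('a) + s * p)"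

text \<open>The \<open>p\<close>-th power of the seminorm with values in \<open>[0, \<infinity>]\<close> and as an iterated integral, so that
  the order of integration can be changed without proving integrability.\<close>

definition gagliardo_energy :: "real \<Rightarrow> real \<Rightarrow> ('a::euclidean_space \<Rightarrow> real) \<Rightarrow> ennreal" where
  "gagliardo_energy s p u = (\<integral>\<^sup>+x. \<integral>\<^sup>+y. ennreal (gagliardo_kernel s p u x y) \<partial>lborel \<partial>lborel)"

text \<open>With this function on the product space the Gagliardo seminorm is an \<open>L\<^sup>p\<close> norm, linear in
  \<open>u\<close> under the norm, and so inherits Minkowski's inequality and Fatou's lemma.\<close>

definition difference_quotient ::
    "real \<Rightarrow> real \<Rightarrow> ('a::euclidean_space \<Rightarrow> real) \<Rightarrow> 'a \<times> 'a \<Rightarrow> real" where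
  "difference_quotient s p u = (\<lambda>(x, y). (u x - u y) / norm (x - y) powr ((real DIM('a) + s * p) / p))"

lemma gagliardo_nonneg[simp]: "gagliardo s p u \<ge> 0"
  by (simp add: gagliardo_def)

lemma gagliardo_kernel_nonneg[simp]: "gagliardo_kernel s p u x y \<ge> 0"
  by (simp add: gagliardo_kernel_def)

lemma gagliardo_kernel_measurable[measurable]:
  fixes u :: "'a::euclidean_space \<Rightarrow> real"
  assumes [measurable]: "u \<in> borel_measurable borel"
  shows "(\<lambda>(x, y). gagliardo_kernel s p u x y) \<in> borel_measurable (borel \<Otimes>\<^sub>M borel)"
  unfolding gagliardo_kernel_def by measurable

lemma nn_integral_lborel_prod_iterated:
  fixes f :: "'a::euclidean_space \<Rightarrow> 'b::euclidean_space \<Rightarrow> ennreal"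
  assumes [measurable]: "(\<lambda>(x, y). f x y) \<in> borel_measurable (borel \<Otimes>\<^sub>M borel)"
  shows "(\<integral>\<^sup>+z. f (fst z) (snd z) \<partial>lborel) = (\<integral>\<^sup>+x. \<integral>\<^sup>+y. f x y \<partial>lborel \<partial>lborel)"
proof -
  have "(\<integral>\<^sup>+x. \<integral>\<^sup>+y. f x y \<partial>lborel \<partial>lborel) = (\<integral>\<^sup>+z. (case z of (x, y) \<Rightarrow> f x y) \<partial>(lborel \<Otimes>\<^sub>M lborel))"
    using lborel.nn_integral_fst[of "\<lambda>(x, y). f x y" lborel] assms by (simp cong: measurable_cong_sets)
  then show ?thesis by (simp add: lborel_prod case_prod_beta)
qed

lemma nn_integral_lborel_swap:
  fixes f :: "'a::euclidean_space \<Rightarrow> 'b::euclidean_space \<Rightarrow> ennreal"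
  assumes [measurable]: "(\<lambda>(x, y). f x y) \<in> borel_measurable (borel \<Otimes>\<^sub>M borel)"
  shows "(\<integral>\<^sup>+x. \<integral>\<^sup>+y. f x y \<partial>lborel \<partial>lborel) = (\<integral>\<^sup>+y. \<integral>\<^sup>+x. f x y \<partial>lborel \<partial>lborel)"
proof -
  have "pair_sigma_finite (lborel :: 'a measure) (lborel :: 'b measure)" ..
  then show ?thesis
    using pair_sigma_finite.Fubini[of lborel lborel "\<lambda>(x, y). f x y"] assms by (simp cong: measurable_cong_sets)
qed

lemma nn_integral_lborel_affine:
  fixes f :: "'a::euclidean_space \<Rightarrow> ennreal"
  assumes [measurable]: "f \<in> borel_measurable borel" and c: "c \<noteq> 0"
  shows "(\<integral>\<^sup>+x. f x \<partial>lborel) = ennreal (\<bar>c\<bar> ^ DIM('a)) * (\<integral>\<^sup>+x. f (t + c *\<^sub>R x) \<partial>lborel)"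
  by (subst lborel_affine[OF c, of t])
     (simp add: nn_integral_density nn_integral_distr nn_integral_cmult)

lemma nn_integral_lborel_reflect:
  fixes f :: "'a::euclidean_space \<Rightarrow> ennreal"
  assumes [measurable]: "f \<in> borel_measurable borel"
  shows "(\<integral>\<^sup>+y. f (x - y) \<partial>lborel) = (\<integral>\<^sup>+y. f y \<partial>lborel)"
  using nn_integral_lborel_affine[OF assms, of "-1" x] by simp

lemma nn_integral_lborel_translate:
  fixes f :: "'a::euclidean_space \<Rightarrow> ennreal"
  assumes [measurable]: "f \<in> borel_measurable borel"
  shows "(\<integral>\<^sup>+y. f (y - x) \<partial>lborel) = (\<integral>\<^sup>+y. f y \<partial>lborel)"
  using nn_integral_lborel_affine[OF assms, of 1 "-x"] by simp

lemma gagliardo_energy_cong_pair: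
  fixes u :: "'a::euclidean_space \<Rightarrow> real"
  assumes [measurable]: "u \<in> borel_measurable borel" and p: "p > 0"
  shows "(\<integral>\<^sup>+z. ennreal (\<bar>difference_quotient s p u z\<bar> powr p) \<partial>lborel) = gagliardo_energy s p u"
proof -
  have "\<bar>difference_quotient s p u z\<bar> powr p = gagliardo_kernel s p u (fst z) (snd z)" for z
    using p by (cases z) (simp add: difference_quotient_def gagliardo_kernel_def powr_divide powr_powr)
  then show ?thesis
    unfolding gagliardo_energy_def by (subst nn_integral_lborel_prod_iterated[symmetric]) auto
qed

lemma gagliardo_eq_Lp_seminorm:
  fixes u :: "'a::euclidean_space \<Rightarrow> real"
  assumes p: "p > 0"
  shows "gagliardo s p u = Lp_seminorm lborel p (difference_quotient s p u)"
proof -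
  have "(case z of (x, y) \<Rightarrow> \<bar>u x - u y\<bar> powr p / norm (x - y) powr (real DIM('a) + s * p))
      = \<bar>difference_quotient s p u z\<bar> powr p" for z
    using p by (cases z) (simp add: difference_quotient_def powr_divide powr_powr)
  then show ?thesis unfolding gagliardo_def Lp_seminorm_def by presburger
qed

lemma difference_quotient_lincomb:
  "difference_quotient s p (\<lambda>x. a * u x + b * v x) =
     (\<lambda>z. a * difference_quotient s p u z + b * difference_quotient s p v z)"
  by (auto simp: difference_quotient_def fun_eq_iff add_divide_distrib[symmetric] algebra_simps)

lemma difference_quotient_diff:
  "difference_quotient s p (\<lambda>x. u x - v x) =
     (\<lambda>z. difference_quotient s p u z - difference_quotient s p v z)"
  using difference_quotient_lincomb[of s p 1 u "-1" v] by simp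

lemma dyadic_bracket:
  fixes t :: real
  assumes "t \<ge> 1"
  shows "\<exists>k. 2 ^ k \<le> t \<and> t \<le> 2 ^ Suc k"
proof -
  define k where "k = nat \<lfloor>log 2 t\<rfloor>"
  have l: "log 2 t \<ge> 0" using assms by simp
  have "real k \<le> log 2 t" "log 2 t \<le> real (Suc k)" using l unfolding k_def by linarith+
  then have "2 powr real k \<le> t" "t \<le> 2 powr real (Suc k)"
    using assms by (auto simp: le_log_iff log_le_iff)
  then show ?thesis by (intro exI[of _ k]) (simp add: powr_realpow del: of_nat_Suc power_Suc)
qed

text \<open>The singular kernel is integrable after truncation: it is dominated by a sum of multiples of
  indicators of balls with dyadic radii, whose integrals form geometric series; the ratio
  \<open>2\<^sup>b\<^sup>-\<^sup>p\<close> belongs to the small radii and \<open>2\<^sup>-\<^sup>b\<close> to the large ones.\<close>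

lemma truncated_kernel_finite:
  assumes b: "0 < b" "b < p"
  shows "(\<integral>\<^sup>+h. ennreal (min 1 (norm h powr p) / norm h powr (real DIM('a) + b)) \<partial>(lborel :: 'a::euclidean_space measure)) < \<infinity>"
proof -
  define N where "N = real DIM('a)"
  define w where "w = unit_ball_vol N"
  have N: "N > 0" and w: "w \<ge> 0" by (auto simp: N_def w_def)
  define c where "c = (\<lambda>k::nat. 2 powr (N + b) * 2 powr (real k * (N + b - p)))"
  define d where "d = (\<lambda>k::nat. 2 powr (- (real k * (N + b))))"
  let ?C = "\<lambda>k::nat. cball (0::'a) (2 powr - real k)" and ?D = "\<lambda>k::nat. cball (0::'a) (2 powr real (Suc k))"
  have [measurable]: "?C k \<in> sets borel" "?D k \<in> sets borel" for k
    by (auto intro: borel_closed)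
  have cd: "c k \<ge> 0" "d k \<ge> 0" for k by (auto simp: c_def d_def)
  have le: "ennreal (min 1 (norm h powr p) / norm h powr (real DIM('a) + b))
      \<le> (\<Sum>k. ennreal (c k) * indicator (?C k) h + ennreal (d k) * indicator (?D k) h)" (is "?l \<le> suminf ?f")
    for h :: 'a
  proof -
    have single: "?f k \<le> suminf ?f" for k
      using sum_le_suminf[of ?f "{k}"] by (simp add: summableI)
    consider "h = 0" | "0 < norm h" "norm h \<le> 1" | "norm h \<ge> 1" by force
    then show ?thesis
    proof cases
      case 2
      obtain k where "2 ^ k \<le> 1 / norm h" "1 / norm h \<le> 2 ^ Suc k"
        using dyadic_bracket[of "1 / norm h"] 2 by auto
      then have "norm h \<le> 1 / 2 ^ k" "1 / 2 ^ Suc k \<le> norm h" using 2 by (auto simp: field_simps)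
      then have k: "norm h \<le> 2 powr (- real k)" "2 powr (- real (Suc k)) \<le> norm h"
        by (auto simp: powr_minus_divide powr_realpow simp del: of_nat_Suc power_Suc)
      have "min 1 (norm h powr p) / norm h powr (N + b) \<le> (2 powr (- real k)) powr p / (2 powr (- real (Suc k))) powr (N + b)"
        using k b N by (intro frac_le min.coboundedI2 powr_mono2) auto
      also have "\<dots> = c k" by (simp add: c_def powr_powr powr_diff[symmetric] powr_add[symmetric] algebra_simps)
      finally have "?l \<le> ennreal (c k)" by (simp add: N_def ennreal_leI)
      also have "\<dots> \<le> ?f k" using k by simp
      finally show ?thesis using single[of k] by simp
    next
      case 3
      obtain k where "2 ^ k \<le> norm h" "norm h \<le> 2 ^ Suc k" using dyadic_bracket[OF 3] by auto
      then have k: "2 powr real k \<le> norm h" "norm h \<le> 2 powr real (Suc k)"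
        by (auto simp del: of_nat_Suc power_Suc simp: powr_realpow)
      have "min 1 (norm h powr p) / norm h powr (N + b) \<le> 1 / (2 powr (real k)) powr (N + b)"
        using k b N by (intro frac_le powr_mono2) auto
      also have "\<dots> = d k" by (simp add: d_def powr_powr powr_minus_divide)
      finally have "?l \<le> ennreal (d k)" by (simp add: N_def ennreal_leI)
      also have "\<dots> \<le> ?f k" using k by (simp del: of_nat_Suc)
      finally show ?thesis using single[of k] by simp
    qed simp
  qed
  have vol: "emeasure lborel (cball (0::'a) r) = ennreal (w * r powr N)" if "r > 0" for r
    using that by (simp add: emeasure_cball w_def N_def powr_realpow)
  have "(\<integral>\<^sup>+h. ennreal (min 1 (norm h powr p) / norm h powr (real DIM('a) + b)) \<partial>(lborel :: 'a measure))
      \<le> (\<integral>\<^sup>+h. (\<Sum>k. ennreal (c k) * indicator (?C k) h + ennreal (d k) * indicator (?D k) h) \<partial>lborel)"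
    by (intro nn_integral_mono le)
  also have "\<dots> = (\<Sum>k. \<integral>\<^sup>+h. ennreal (c k) * indicator (?C k) h + ennreal (d k) * indicator (?D k) h \<partial>lborel)"
    by (intro nn_integral_suminf) measurable
  also have "\<dots> = (\<Sum>k. ennreal (c k) * emeasure lborel (?C k) + ennreal (d k) * emeasure lborel (?D k))"
    by (intro arg_cong[where f = suminf] ext) (simp add: nn_integral_add nn_integral_cmult del: of_nat_Suc)
  also have "\<dots> = (\<Sum>k. ennreal (w * 2 powr (N + b) * (2 powr (b - p)) ^ k + w * 2 powr N * (2 powr (- b)) ^ k))"
  proof (intro arg_cong[where f = suminf] ext)
    fix k
    have 1: "c k * (w * (2 powr - real k) powr N) = w * 2 powr (N + b) * (2 powr (b - p)) ^ k"
      by (simp add: c_def powr_powr powr_add[symmetric] powr_realpow[symmetric] algebra_simps)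
    have 2: "d k * (w * (2 powr real (Suc k)) powr N) = w * 2 powr N * (2 powr (- b)) ^ k"
      by (simp add: d_def powr_powr powr_add[symmetric] powr_realpow[symmetric] algebra_simps)
    show "ennreal (c k) * emeasure lborel (?C k) + ennreal (d k) * emeasure lborel (?D k) =
      ennreal (w * 2 powr (N + b) * (2 powr (b - p)) ^ k + w * 2 powr N * (2 powr (- b)) ^ k)"
      using w cd by (simp add: vol ennreal_mult[symmetric] ennreal_plus[symmetric] 1 2 del: ennreal_plus of_nat_Suc)
  qed
  also have "\<dots> < \<infinity>"
    using w b by (subst suminf_ennreal2) (auto intro!: summable_add summable_mult summable_geometric simp: powr_less_one)
  finally show ?thesis .
qed

text \<open>A test function is bounded, Lipschitz and supported in a ball \<open>S\<close>. So the kernel is at most a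
  multiple of the truncated kernel in \<open>x - y\<close>, and it vanishes unless \<open>x\<close> or \<open>y\<close> lies in \<open>S\<close>,
  which makes the remaining integration finite.\<close>

lemma test_function_energy_finite:
  fixes u :: "'a::euclidean_space \<Rightarrow> real"
  assumes u: "u \<in> test_functions \<Omega>" and p: "1 < p" and s: "0 < s" "s < 1"
  shows "gagliardo_energy s p u < \<infinity>"
proof -
  note [measurable] = u
  obtain L where L: "L > 0" "\<And>x y. \<bar>u x - u y\<bar> \<le> L * norm (x - y)" using test_function_Lipschitz[OF u] by blast
  obtain B where B: "B > 0" "\<And>x. \<bar>u x\<bar> \<le> B" using test_function_bounded[OF u] by blast
  obtain \<rho> where \<rho>: "\<And>x. u x \<noteq> 0 \<Longrightarrow> norm x < \<rho>" using test_function_bounded_support[OF u] by blast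
  define S where "S = ball (0::'a) \<rho>"
  define K where "K = max ((2 * B) powr p) (L powr p)"
  define k :: "'a \<Rightarrow> ennreal" where "k = (\<lambda>h. ennreal (min 1 (norm h powr p) / norm h powr (real DIM('a) + s * p)))"
  have [measurable]: "S \<in> sets borel" "k \<in> borel_measurable borel" unfolding S_def k_def by measurable
  define I where "I = (\<integral>\<^sup>+h. k h \<partial>lborel)"
  have I: "I < \<infinity>"
    unfolding I_def k_def using p s by (intro truncated_kernel_finite) auto
  have K: "K \<ge> 0" by (simp add: K_def le_max_iff_disj)
  have num: "\<bar>u x - u y\<bar> powr p \<le> K * min 1 (norm (x - y) powr p)" for x y
  proof -
    have "\<bar>u x - u y\<bar> powr p \<le> (2 * B) powr p"
      using B(2)[of x] B(2)[of y] p by (intro powr_mono2) auto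
    moreover have "\<bar>u x - u y\<bar> powr p \<le> L powr p * norm (x - y) powr p"
      using L(2)[of x y] p powr_mono2[of p "\<bar>u x - u y\<bar>" "L * norm (x - y)"] by (simp add: powr_mult)
    moreover have "L powr p * norm (x - y) powr p \<le> K * norm (x - y) powr p"
      by (intro mult_right_mono) (auto simp: K_def)
    ultimately show ?thesis by (auto simp: K_def min_def)
  qed
  have le: "ennreal (gagliardo_kernel s p u x y)
      \<le> ennreal K * (indicator S x * k (x - y) + indicator S y * k (x - y))" for x y
  proof (cases "x \<in> S \<or> y \<in> S")
    case True
    have "ennreal (gagliardo_kernel s p u x y) \<le> ennreal (K * (min 1 (norm (x - y) powr p) / norm (x - y) powr (real DIM('a) + s * p)))"
      unfolding gagliardo_kernel_def using divide_right_mono[OF num[of x y]] by (intro ennreal_leI) simp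
    also have "\<dots> = ennreal K * k (x - y)" using K unfolding k_def by (intro ennreal_mult) auto
    also have "\<dots> \<le> ennreal K * (indicator S x * k (x - y) + indicator S y * k (x - y))"
      using True by (intro mult_left_mono) (auto simp: indicator_def)
    finally show ?thesis .
  next
    case False
    then have "u x = 0" "u y = 0" using \<rho> by (force simp: S_def)+
    then show ?thesis by (simp add: gagliardo_kernel_def)
  qed
  have I1: "(\<integral>\<^sup>+y. k (x - y) \<partial>lborel) = I" for x
    unfolding I_def by (rule nn_integral_lborel_reflect) measurable
  have I2: "(\<integral>\<^sup>+x. k (x - y) \<partial>lborel) = I" for y
    unfolding I_def by (rule nn_integral_lborel_translate) measurable
  have "gagliardo_energy s p u \<le>
      (\<integral>\<^sup>+x. \<integral>\<^sup>+y. ennreal K * (indicator S x * k (x - y) + indicator S y * k (x - y)) \<partial>lborel \<partial>lborel)"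
    unfolding gagliardo_energy_def by (intro nn_integral_mono le)
  also have "\<dots> = ennreal K * ((\<integral>\<^sup>+x. \<integral>\<^sup>+y. indicator S x * k (x - y) \<partial>lborel \<partial>lborel) +
      (\<integral>\<^sup>+x. \<integral>\<^sup>+y. indicator S y * k (x - y) \<partial>lborel \<partial>lborel))"
    by (simp add: nn_integral_cmult nn_integral_add)
  also have "(\<integral>\<^sup>+x. \<integral>\<^sup>+y. indicator S y * k (x - y) \<partial>lborel \<partial>lborel) = (\<integral>\<^sup>+y. \<integral>\<^sup>+x. indicator S y * k (x - y) \<partial>lborel \<partial>lborel)"
    by (rule nn_integral_lborel_swap) measurable
  also have "\<dots> = emeasure lborel S * I"
    by (simp add: nn_integral_cmult nn_integral_multc I2)
  also have "(\<integral>\<^sup>+x. \<integral>\<^sup>+y. indicator S x * k (x - y) \<partial>lborel \<partial>lborel) = emeasure lborel S * I"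
    by (simp add: nn_integral_cmult nn_integral_multc I1)
  also have "ennreal K * (emeasure lborel S * I + emeasure lborel S * I) < \<infinity>"
    using I emeasure_lborel_ball_finite[of "0::'a" \<rho>] by (simp add: S_def ennreal_mult_less_top)
  finally show ?thesis .
qed

lemma difference_quotient_measurable[measurable]:
  fixes u :: "'a::euclidean_space \<Rightarrow> real"
  assumes [measurable]: "u \<in> borel_measurable borel"
  shows "difference_quotient s p u \<in> borel_measurable borel"
  unfolding difference_quotient_def borel_prod[symmetric] by measurable

lemma difference_quotient_in_Lp:
  fixes u :: "'a::euclidean_space \<Rightarrow> real"
  assumes u: "u \<in> test_functions \<Omega>" and p: "1 < p" and s: "0 < s" "s < 1"
  shows "difference_quotient s p u \<in> Lp_functions lborel p"
proof -
  note [measurable] = u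
  have "integrable lborel (\<lambda>z. \<bar>difference_quotient s p u z\<bar> powr p)"
    using test_function_energy_finite[OF assms] p
    by (intro integrableI_nonneg) (auto simp: gagliardo_energy_cong_pair)
  then show ?thesis by (simp add: Lp_functions_def)
qed

lemma gagliardo_energy_eq:
  fixes u :: "'a::euclidean_space \<Rightarrow> real"
  assumes u: "u \<in> test_functions \<Omega>" and p: "1 < p" and s: "0 < s" "s < 1"
  shows "gagliardo_energy s p u = ennreal (gagliardo s p u powr p)"
proof -
  note [measurable] = u
  have "gagliardo_energy s p u = (\<integral>\<^sup>+z. ennreal (\<bar>difference_quotient s p u z\<bar> powr p) \<partial>lborel)"
    using p by (subst gagliardo_energy_cong_pair) auto
  also have "\<dots> = ennreal (\<integral>z. \<bar>difference_quotient s p u z\<bar> powr p \<partial>lborel)"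
    using Lp_integrable[OF difference_quotient_in_Lp[OF assms]] by (intro nn_integral_eq_integral) auto
  finally show ?thesis
    using p by (simp add: gagliardo_eq_Lp_seminorm integral_eq_Lp_seminorm_powr)
qed

section \<open>The embedding as an inequality\<close>

definition energy_bounds_Lp :: "real \<Rightarrow> real \<Rightarrow> real \<Rightarrow> 'a::euclidean_space set \<Rightarrow> bool" where
  "energy_bounds_Lp s p q \<Omega> \<longleftrightarrow>
    (\<exists>C. \<forall>u\<in>test_functions \<Omega>. Lp_seminorm lborel q u \<le> C * gagliardo s p u)"

lemma Lq_functions_eq: "Lq_functions q \<Omega> = Lp_functions (lebesgue_on \<Omega>) q"
  by (simp add: Lq_functions_def Lp_functions_def)

lemma test_function_in_Lp_lborel:
  fixes u :: "'a::euclidean_space \<Rightarrow> real"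
  assumes u: "u \<in> test_functions \<Omega>" and q: "q \<ge> 0"
  shows "u \<in> Lp_functions lborel q"
proof -
  note [measurable] = u
  obtain B where B: "B > 0" "\<And>x. \<bar>u x\<bar> \<le> B" using test_function_bounded[OF u] by blast
  obtain \<rho> where \<rho>: "\<And>x. u x \<noteq> 0 \<Longrightarrow> norm x < \<rho>" using test_function_bounded_support[OF u] by blast
  have "integrable lborel (\<lambda>x. \<bar>u x\<bar> powr q)"
  proof (rule Bochner_Integration.integrable_bound)
    show "integrable lborel (\<lambda>x. B powr q * indicator (ball 0 \<rho> :: 'a set) x)"
      using emeasure_lborel_ball_finite[of "0::'a" \<rho>] by (intro integrable_mult_right) (simp add: integrable_indicator_iff)
    show "AE x in lborel. norm (\<bar>u x\<bar> powr q) \<le> norm (B powr q * indicator (ball 0 \<rho>) x)"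
    proof (intro AE_I2)
      fix x show "norm (\<bar>u x\<bar> powr q) \<le> norm (B powr q * indicator (ball 0 \<rho>) x)"
        using \<rho>[of x] B(2)[of x] q by (cases "u x = 0") (auto intro: powr_mono2)
    qed
  qed simp
  then show ?thesis by (simp add: Lp_functions_def)
qed

lemma test_function_restrict_Lp:
  fixes u :: "'a::euclidean_space \<Rightarrow> real"
  assumes u: "u \<in> test_functions \<Omega>" and q: "q \<ge> 0" and \<Omega>: "open \<Omega>"
  shows "u \<in> Lp_functions (lebesgue_on \<Omega>) q"
    and "Lp_seminorm (lebesgue_on \<Omega>) q u = Lp_seminorm lborel q u"
proof -
  note [measurable] = u
  have [simp]: "\<Omega> \<in> sets lebesgue" using \<Omega> by auto
  have eq: "(\<lambda>x. indicator \<Omega> x *\<^sub>R \<bar>u x\<bar> powr q) = (\<lambda>x. \<bar>u x\<bar> powr q)"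
    using test_function_eq_0[OF u] by (auto simp: fun_eq_iff indicator_def)
  have [measurable]: "(\<lambda>x. \<bar>u x\<bar> powr q) \<in> borel_measurable lborel" by measurable
  have "u \<in> borel_measurable lebesgue"
    by (intro measurable_completion) measurable
  then have "u \<in> borel_measurable (lebesgue_on \<Omega>)" by (rule measurable_restrict_space1)
  moreover have "integrable (lebesgue_on \<Omega>) (\<lambda>x. \<bar>u x\<bar> powr q)"
    using Lp_integrable[OF test_function_in_Lp_lborel[OF u q]]
    by (subst integrable_restrict_space) (simp_all only: eq integrable_completion \<open>\<Omega> \<in> sets lebesgue\<close> sets.Int_space_eq2 \<open>(\<lambda>x. \<bar>u x\<bar> powr q) \<in> borel_measurable lborel\<close>)
  ultimately show "u \<in> Lp_functions (lebesgue_on \<Omega>) q" by (simp add: Lp_functions_def)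
  show "Lp_seminorm (lebesgue_on \<Omega>) q u = Lp_seminorm lborel q u"
    unfolding Lp_seminorm_def
    by (subst integral_restrict_space) (simp_all only: eq integral_completion \<open>\<Omega> \<in> sets lebesgue\<close> sets.Int_space_eq2 \<open>(\<lambda>x. \<bar>u x\<bar> powr q) \<in> borel_measurable lborel\<close>)
qed

lemma AE_lborel_pair:
  assumes "AE x in (lborel :: 'a::euclidean_space measure). P x"
  shows "AE z in (lborel :: ('a \<times> 'a) measure). P (fst z) \<and> P (snd z)"
proof -
  obtain N where N: "N \<in> null_sets lborel" "{x. \<not> P x} \<subseteq> N"
    using assms by (auto simp: eventually_ae_filter)
  have "N \<times> UNIV \<in> null_sets (lborel \<Otimes>\<^sub>M (lborel :: 'a measure))"
    using N(1) by (intro lborel.times_in_null_sets1) auto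
  moreover have "UNIV \<times> N \<in> null_sets ((lborel :: 'a measure) \<Otimes>\<^sub>M lborel)"
    using N(1) by (intro lborel.times_in_null_sets2) auto
  ultimately have "N \<times> UNIV \<union> UNIV \<times> N \<in> null_sets (lborel :: ('a \<times> 'a) measure)"
    by (simp add: lborel_prod null_sets.Un)
  then show ?thesis
    using N(2) by (intro AE_I'[of "N \<times> UNIV \<union> UNIV \<times> N"]) auto
qed

lemma LIMSEQ_0_if_le:
  fixes f g :: "nat \<Rightarrow> real"
  assumes "g \<longlonglongrightarrow> 0" "\<And>n. 0 \<le> f n" "\<And>n. f n \<le> g n"
  shows "f \<longlonglongrightarrow> 0"
  by (rule Lim_null_comparison[OF _ assms(1)]) (use assms in auto)

lemma Lq_class_norm:
  assumes "f \<in> Lq_functions q \<Omega>"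
  shows "Lq_norm q \<Omega> (ae_rel q \<Omega> `` {f}) = Lp_seminorm (lebesgue_on \<Omega>) q f"
proof -
  have *: "Lp_seminorm (lebesgue_on \<Omega>) q g = Lp_seminorm (lebesgue_on \<Omega>) q f"
    if "g \<in> ae_rel q \<Omega> `` {f}" for g
    using that by (intro Lp_seminorm_cong_AE) (auto simp: ae_rel_def Lq_functions_eq)
  have f: "f \<in> ae_rel q \<Omega> `` {f}" using assms by (auto simp: ae_rel_def)
  show ?thesis
    unfolding Lq_norm_def Lp_seminorm_def[symmetric]
  proof (rule the_equality)
    show "\<forall>g\<in>ae_rel q \<Omega> `` {f}. Lp_seminorm (lebesgue_on \<Omega>) q g = Lp_seminorm (lebesgue_on \<Omega>) q f"
      using * by blast
    show "r = Lp_seminorm (lebesgue_on \<Omega>) q f"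
      if "\<forall>g\<in>ae_rel q \<Omega> `` {f}. Lp_seminorm (lebesgue_on \<Omega>) q g = r" for r
      using bspec[OF that f] by (rule sym)
  qed
qed

context
  fixes s p :: real and \<Omega> :: "'a::euclidean_space set"
  assumes p: "1 < p" and s: "0 < s" "s < 1"
begin

private abbreviation "G \<equiv> gagliardo s p"

lemma gagliardo_lincomb_le:
  assumes "u \<in> test_functions \<Omega>" "v \<in> test_functions \<Omega>"
  shows "gagliardo s p (\<lambda>x. a * u x + b * v x) \<le> \<bar>a\<bar> * gagliardo s p u + \<bar>b\<bar> * gagliardo s p v"
  using p difference_quotient_in_Lp[OF assms(1) p s] difference_quotient_in_Lp[OF assms(2) p s]
    Lp_seminorm_triangle[of p "\<lambda>z. a * difference_quotient s p u z" lborel "\<lambda>z. b * difference_quotient s p v z"]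
  by (simp add: gagliardo_eq_Lp_seminorm difference_quotient_lincomb Lp_scale Lp_seminorm_scale)

lemma gagliardo_triangle_diff:
  assumes "u \<in> test_functions \<Omega>" "v \<in> test_functions \<Omega>" "w \<in> test_functions \<Omega>"
  shows "gagliardo s p (\<lambda>x. u x - w x) \<le> gagliardo s p (\<lambda>x. u x - v x) + gagliardo s p (\<lambda>x. v x - w x)"
  using gagliardo_lincomb_le[OF test_functions_diff[OF assms(1,2)] test_functions_diff[OF assms(2,3)], of 1 1]
  by simp

lemma gagliardo_minus_commute: "gagliardo s p (\<lambda>x. u x - v x) = gagliardo s p (\<lambda>x. v x - u x)"
  using p Lp_seminorm_minus_commute[of lborel p "difference_quotient s p u" "difference_quotient s p v"]
  by (simp add: gagliardo_eq_Lp_seminorm difference_quotient_diff)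

lemma gagliardo_reverse_triangle:
  assumes "u \<in> test_functions \<Omega>" "v \<in> test_functions \<Omega>"
  shows "\<bar>gagliardo s p u - gagliardo s p v\<bar> \<le> gagliardo s p (\<lambda>x. u x - v x)"
  using p difference_quotient_in_Lp[OF assms(1) p s] difference_quotient_in_Lp[OF assms(2) p s]
    Lp_seminorm_reverse_triangle[of p "difference_quotient s p u" lborel "difference_quotient s p v"]
  by (simp add: gagliardo_eq_Lp_seminorm difference_quotient_diff)

lemma cauchy_seqsD:
  assumes "U \<in> cauchy_seqs s p \<Omega>" "e > 0"
  obtains M where "\<And>m n. m \<ge> M \<Longrightarrow> n \<ge> M \<Longrightarrow> gagliardo s p (\<lambda>x. U m x - U n x) < e"
  using assms unfolding cauchy_seqs_def by blast

lemma cauchy_seqs_test: "U \<in> cauchy_seqs s p \<Omega> \<Longrightarrow> U n \<in> test_functions \<Omega>"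
  by (simp add: cauchy_seqs_def)

lemma gagliardo_zero: "gagliardo s p (\<lambda>x::'a. 0) = 0"
proof -
  have "difference_quotient s p (\<lambda>x::'a. 0) = (\<lambda>z. 0)"
    by (auto simp: difference_quotient_def)
  then show ?thesis
    using p by (simp add: gagliardo_eq_Lp_seminorm Lp_seminorm_def)
qed

lemma cauchy_seqs_const: "u \<in> test_functions \<Omega> \<Longrightarrow> (\<lambda>n. u) \<in> cauchy_seqs s p \<Omega>"
  by (simp add: cauchy_seqs_def gagliardo_zero)

lemma cauchy_seqs_lincomb:
  assumes U: "U \<in> cauchy_seqs s p \<Omega>" and V: "V \<in> cauchy_seqs s p \<Omega>"
  shows "(\<lambda>n x. a * U n x + b * V n x) \<in> cauchy_seqs s p \<Omega>"
  unfolding cauchy_seqs_def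
proof (intro CollectI conjI allI impI)
  show "(\<lambda>x. a * U n x + b * V n x) \<in> test_functions \<Omega>" for n
    using assms[THEN cauchy_seqs_test] by (intro test_functions_lincomb)
  fix e :: real assume "e > 0"
  define d where "d = e / (\<bar>a\<bar> + \<bar>b\<bar> + 1)"
  have d: "d > 0" "(\<bar>a\<bar> + \<bar>b\<bar>) * d < e" using \<open>e > 0\<close> by (auto simp: d_def field_simps)
  obtain M1 where M1: "\<And>m n. m \<ge> M1 \<Longrightarrow> n \<ge> M1 \<Longrightarrow> G (\<lambda>x. U m x - U n x) < d"
    using cauchy_seqsD[OF U d(1)] by blast
  obtain M2 where M2: "\<And>m n. m \<ge> M2 \<Longrightarrow> n \<ge> M2 \<Longrightarrow> G (\<lambda>x. V m x - V n x) < d"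
    using cauchy_seqsD[OF V d(1)] by blast
  show "\<exists>M. \<forall>m\<ge>M. \<forall>n\<ge>M. G (\<lambda>x. (a * U m x + b * V m x) - (a * U n x + b * V n x)) < e"
  proof (intro exI[of _ "max M1 M2"] allI impI)
    fix m n assume mn: "m \<ge> max M1 M2" "n \<ge> max M1 M2"
    have "G (\<lambda>x. (a * U m x + b * V m x) - (a * U n x + b * V n x)) =
        G (\<lambda>x. a * (U m x - U n x) + b * (V m x - V n x))" by (simp add: algebra_simps)
    also have "\<dots> \<le> \<bar>a\<bar> * G (\<lambda>x. U m x - U n x) + \<bar>b\<bar> * G (\<lambda>x. V m x - V n x)"
      using U V by (intro gagliardo_lincomb_le test_functions_diff cauchy_seqs_test)
    also have "\<dots> \<le> \<bar>a\<bar> * d + \<bar>b\<bar> * d"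
      using mn M1[of m n] M2[of m n] by (intro add_mono mult_left_mono) auto
    also have "\<dots> < e" using d by (simp add: algebra_simps)
    finally show "G (\<lambda>x. (a * U m x + b * V m x) - (a * U n x + b * V n x)) < e" .
  qed
qed

lemma equiv_null_rel: "equiv (cauchy_seqs s p \<Omega>) (null_rel s p \<Omega>)"
proof (rule equivI)
  show "null_rel s p \<Omega> \<subseteq> cauchy_seqs s p \<Omega> \<times> cauchy_seqs s p \<Omega>" by (auto simp: null_rel_def)
  show "refl_on (cauchy_seqs s p \<Omega>) (null_rel s p \<Omega>)"
    by (auto simp: refl_on_def null_rel_def gagliardo_zero)
  show "sym (null_rel s p \<Omega>)"
  proof (rule symI)
    fix U V assume "(U, V) \<in> null_rel s p \<Omega>"
    then show "(V, U) \<in> null_rel s p \<Omega>"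
      using gagliardo_minus_commute[of "U n" "V n" for n] by (simp add: null_rel_def)
  qed
  show "trans (null_rel s p \<Omega>)"
  proof (rule transI)
    fix U V W assume UV: "(U, V) \<in> null_rel s p \<Omega>" and VW: "(V, W) \<in> null_rel s p \<Omega>"
    have t: "U n \<in> test_functions \<Omega>" "V n \<in> test_functions \<Omega>" "W n \<in> test_functions \<Omega>" for n
      using UV VW by (auto simp: null_rel_def intro: cauchy_seqs_test)
    have "(\<lambda>n. G (\<lambda>x. U n x - V n x) + G (\<lambda>x. V n x - W n x)) \<longlonglongrightarrow> 0"
      using UV VW by (intro tendsto_add_zero) (auto simp: null_rel_def)
    then have "(\<lambda>n. G (\<lambda>x. U n x - W n x)) \<longlonglongrightarrow> 0"
      by (rule LIMSEQ_0_if_le) (use gagliardo_triangle_diff[OF t] in auto)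
    then show "(U, W) \<in> null_rel s p \<Omega>" using UV VW by (auto simp: null_rel_def)
  qed
qed

text \<open>The norms along a Cauchy sequence converge by the reverse triangle inequality, and equivalent
  sequences have the same limit, so the definite description in \<open>D0_norm\<close> picks out this limit.\<close>

lemma D0_norm_class:
  assumes U: "U \<in> cauchy_seqs s p \<Omega>"
  shows "(\<lambda>n. gagliardo s p (U n)) \<longlonglongrightarrow> D0_norm s p (null_rel s p \<Omega> `` {U})"
proof -
  have "Cauchy (\<lambda>n. G (U n))"
  proof (rule metric_CauchyI)
    fix e :: real assume e: "e > 0"
    obtain M where "\<And>m n. m \<ge> M \<Longrightarrow> n \<ge> M \<Longrightarrow> G (\<lambda>x. U m x - U n x) < e"
      using cauchy_seqsD[OF U e] by blast
    then show "\<exists>M. \<forall>m\<ge>M. \<forall>n\<ge>M. dist (G (U m)) (G (U n)) < e"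
      using gagliardo_reverse_triangle[OF cauchy_seqs_test[OF U] cauchy_seqs_test[OF U]]
      by (intro exI[of _ M]) (metis dist_real_def le_less_trans)
  qed
  then obtain r where r: "(\<lambda>n. G (U n)) \<longlonglongrightarrow> r" by (auto simp: Cauchy_convergent_iff convergent_def)
  have V: "(\<lambda>n. G (V n)) \<longlonglongrightarrow> r" if "V \<in> null_rel s p \<Omega> `` {U}" for V
  proof -
    have VU: "V \<in> cauchy_seqs s p \<Omega>" "(\<lambda>n. G (\<lambda>x. U n x - V n x)) \<longlonglongrightarrow> 0"
      using that by (auto simp: null_rel_def)
    have "(\<lambda>n. G (U n) - G (V n)) \<longlonglongrightarrow> 0"
      using gagliardo_reverse_triangle[OF cauchy_seqs_test[OF U] cauchy_seqs_test[OF VU(1)]]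
      by (intro Lim_null_comparison[OF always_eventually VU(2)]) auto
    from tendsto_diff[OF r this] show ?thesis by simp
  qed
  have "U \<in> null_rel s p \<Omega> `` {U}" using equiv_class_self[OF equiv_null_rel U] .
  then have "D0_norm s p (null_rel s p \<Omega> `` {U}) = r"
    unfolding D0_norm_def using V r LIMSEQ_unique by (intro the_equality) blast+
  with r show ?thesis by simp
qed

lemma D0_norm_const:
  assumes u: "u \<in> test_functions \<Omega>"
  shows "D0_norm s p (null_rel s p \<Omega> `` {\<lambda>n. u}) = gagliardo s p u"
  using D0_norm_class[OF cauchy_seqs_const[OF u]] LIMSEQ_const_iff by metis

lemma continuously_embedded_imp_inequality:
  assumes E: "continuously_embedded s p q \<Omega>" and q: "q \<ge> 1" and \<Omega>: "open \<Omega>"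
  shows "\<exists>C. \<forall>u\<in>test_functions \<Omega>. Lp_seminorm lborel q u \<le> C * gagliardo s p u"
proof -
  obtain J C where C: "\<And>X. X \<in> D0 s p \<Omega> \<Longrightarrow> Lq_norm q \<Omega> (J X) \<le> C * D0_norm s p X"
    and J: "\<And>u. u \<in> test_functions \<Omega> \<Longrightarrow> J (null_rel s p \<Omega> `` {\<lambda>n. u}) = ae_rel q \<Omega> `` {u}"
    using E unfolding continuously_embedded_def by blast
  have "Lp_seminorm lborel q u \<le> C * G u" if u: "u \<in> test_functions \<Omega>" for u
  proof -
    have "null_rel s p \<Omega> `` {\<lambda>n. u} \<in> D0 s p \<Omega>"
      unfolding D0_def using cauchy_seqs_const[OF u] by (intro quotientI)
    from C[OF this] show ?thesis
      using test_function_restrict_Lp[OF u _ \<Omega>, of q] q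
      by (simp add: J[OF u] D0_norm_const[OF u] Lq_class_norm Lq_functions_eq)
  qed
  then show ?thesis by blast
qed

context
  fixes q C :: real
  assumes q: "q \<ge> 1" and \<Omega>: "open \<Omega>"
    and le: "\<And>u. u \<in> test_functions \<Omega> \<Longrightarrow> Lp_seminorm lborel q u \<le> C * gagliardo s p u"
begin

private abbreviation "nrm \<equiv> Lp_seminorm (lebesgue_on \<Omega>) q"

text \<open>This is the embedding. Collecting all limits of all representatives makes its values whole
  \<open>L\<^sup>q\<close> classes, so that nothing has to be chosen.\<close>

private definition limits :: "(nat \<Rightarrow> 'a \<Rightarrow> real) set \<Rightarrow> ('a \<Rightarrow> real) set" where
  "limits X = {f \<in> Lq_functions q \<Omega>. \<exists>U\<in>X. (\<lambda>n. nrm (\<lambda>x. U n x - f x)) \<longlonglongrightarrow> 0}"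

private lemma nrm_le: "u \<in> test_functions \<Omega> \<Longrightarrow> nrm u \<le> C * G u"
  using le[of u] test_function_restrict_Lp(2)[of u \<Omega> q] q \<Omega> by simp

private lemma in_Lp: "u \<in> test_functions \<Omega> \<Longrightarrow> u \<in> Lp_functions (lebesgue_on \<Omega>) q"
  using test_function_restrict_Lp(1)[of u \<Omega> q] q \<Omega> by simp

private lemma in_Lp_cauchy: "U \<in> cauchy_seqs s p \<Omega> \<Longrightarrow> U n \<in> Lp_functions (lebesgue_on \<Omega>) q"
  by (intro in_Lp cauchy_seqs_test)

private lemma cauchy_seqs_Lp_Cauchy:
  assumes U: "U \<in> cauchy_seqs s p \<Omega>" and e: "e > 0"
  shows "\<exists>N. \<forall>m\<ge>N. \<forall>n\<ge>N. nrm (\<lambda>x. U m x - U n x) < e"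
proof -
  have d: "e / (\<bar>C\<bar> + 1) > 0" using e by simp
  obtain N where N: "\<And>m n. m \<ge> N \<Longrightarrow> n \<ge> N \<Longrightarrow> G (\<lambda>x. U m x - U n x) < e / (\<bar>C\<bar> + 1)"
    using cauchy_seqsD[OF U d] by blast
  have "nrm (\<lambda>x. U m x - U n x) < e" if "m \<ge> N" "n \<ge> N" for m n
  proof -
    have "nrm (\<lambda>x. U m x - U n x) \<le> C * G (\<lambda>x. U m x - U n x)"
      using U by (intro nrm_le test_functions_diff cauchy_seqs_test)
    also have "\<dots> \<le> (\<bar>C\<bar> + 1) * G (\<lambda>x. U m x - U n x)"
      by (intro mult_right_mono) auto
    also have "\<dots> < e" using N[OF that] by (simp add: field_simps)
    finally show ?thesis .
  qed
  then show ?thesis by blast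
qed

private lemma limit_exists:
  assumes U: "U \<in> cauchy_seqs s p \<Omega>"
  obtains f r where "f \<in> Lq_functions q \<Omega>" "strict_mono r"
    "AE x in lebesgue_on \<Omega>. (\<lambda>k. U (r k) x) \<longlonglongrightarrow> f x" "(\<lambda>n. nrm (\<lambda>x. U n x - f x)) \<longlonglongrightarrow> 0"
  by (rule Riesz_Fischer[OF q in_Lp_cauchy[OF U] cauchy_seqs_Lp_Cauchy[OF U]])
     (auto simp: Lq_functions_eq)

private lemma limit_cong:
  assumes UV: "(U, V) \<in> null_rel s p \<Omega>" and f: "f \<in> Lq_functions q \<Omega>"
    and lim: "(\<lambda>n. nrm (\<lambda>x. U n x - f x)) \<longlonglongrightarrow> 0"
  shows "(\<lambda>n. nrm (\<lambda>x. V n x - f x)) \<longlonglongrightarrow> 0"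
proof -
  have U: "U \<in> cauchy_seqs s p \<Omega>" and V: "V \<in> cauchy_seqs s p \<Omega>" using UV by (auto simp: null_rel_def)
  have b: "nrm (\<lambda>x. V n x - f x) \<le> C * G (\<lambda>x. U n x - V n x) + nrm (\<lambda>x. U n x - f x)" for n
  proof -
    have "nrm (\<lambda>x. V n x - f x) \<le> nrm (\<lambda>x. V n x - U n x) + nrm (\<lambda>x. U n x - f x)"
      using f in_Lp_cauchy[OF U] in_Lp_cauchy[OF V] unfolding Lq_functions_eq
      by (intro Lp_seminorm_triangle_diff q)
    moreover have "nrm (\<lambda>x. V n x - U n x) \<le> C * G (\<lambda>x. V n x - U n x)"
      using U V by (intro nrm_le test_functions_diff cauchy_seqs_test)
    ultimately show ?thesis by (simp add: gagliardo_minus_commute[of "U n"])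
  qed
  have "(\<lambda>n. C * G (\<lambda>x. U n x - V n x) + nrm (\<lambda>x. U n x - f x)) \<longlonglongrightarrow> 0"
    using UV lim by (intro tendsto_add_zero tendsto_mult_right_zero) (auto simp: null_rel_def)
  then show ?thesis
    by (rule LIMSEQ_0_if_le) (use b in auto)
qed

private lemma limits_class_iff:
  assumes U: "U \<in> cauchy_seqs s p \<Omega>"
  shows "f \<in> limits (null_rel s p \<Omega> `` {U}) \<longleftrightarrow>
    f \<in> Lq_functions q \<Omega> \<and> (\<lambda>n. nrm (\<lambda>x. U n x - f x)) \<longlonglongrightarrow> 0"
proof -
  have "U \<in> null_rel s p \<Omega> `` {U}" using equiv_class_self[OF equiv_null_rel U] .
  moreover have "(V, U) \<in> null_rel s p \<Omega>" if "V \<in> null_rel s p \<Omega> `` {U}" for V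
    using that equiv_null_rel by (auto simp: equiv_def dest: symD)
  ultimately show ?thesis
    by (auto simp: limits_def intro: limit_cong)
qed

private lemma limits_class:
  assumes U: "U \<in> cauchy_seqs s p \<Omega>" and f: "f \<in> limits (null_rel s p \<Omega> `` {U})"
  shows "limits (null_rel s p \<Omega> `` {U}) = ae_rel q \<Omega> `` {f}"
proof (rule set_eqI)
  fix g
  note f = f[unfolded limits_class_iff[OF U]]
  have UL: "U n \<in> Lp_functions (lebesgue_on \<Omega>) q" for n using in_Lp_cauchy[OF U] .
  show "g \<in> limits (null_rel s p \<Omega> `` {U}) \<longleftrightarrow> g \<in> ae_rel q \<Omega> `` {f}"
  proof
    assume "g \<in> limits (null_rel s p \<Omega> `` {U})"
    then have g: "g \<in> Lq_functions q \<Omega>" "(\<lambda>n. nrm (\<lambda>x. U n x - g x)) \<longlonglongrightarrow> 0"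
      by (auto simp: limits_class_iff[OF U])
    have "nrm (\<lambda>x. f x - g x) \<le> nrm (\<lambda>x. U n x - f x) + nrm (\<lambda>x. U n x - g x)" for n
      using Lp_seminorm_triangle_diff[OF q, of f _ "U n" g] f g UL
      by (simp add: Lq_functions_eq Lp_seminorm_minus_commute[of _ _ f])
    moreover have "(\<lambda>n. nrm (\<lambda>x. U n x - f x) + nrm (\<lambda>x. U n x - g x)) \<longlonglongrightarrow> 0 + 0"
      using f g by (intro tendsto_add) auto
    ultimately have "nrm (\<lambda>x. f x - g x) \<le> 0"
      by (intro LIMSEQ_le_const[where X = "\<lambda>n. nrm (\<lambda>x. U n x - f x) + nrm (\<lambda>x. U n x - g x)"]) auto
    then have "nrm (\<lambda>x. f x - g x) = 0" using Lp_seminorm_nonneg by (intro antisym)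
    then have "AE x in lebesgue_on \<Omega>. f x - g x = 0"
      using f g q by (subst (asm) Lp_seminorm_eq_0_iff) (auto simp: Lq_functions_eq intro!: Lp_diff)
    then show "g \<in> ae_rel q \<Omega> `` {f}" using f g by (auto simp: ae_rel_def)
  next
    assume "g \<in> ae_rel q \<Omega> `` {f}"
    then have g: "g \<in> Lq_functions q \<Omega>" "AE x in lebesgue_on \<Omega>. f x = g x" by (auto simp: ae_rel_def)
    have "nrm (\<lambda>x. U n x - g x) = nrm (\<lambda>x. U n x - f x)" for n
      using f g q UL by (intro Lp_seminorm_cong_AE Lp_diff) (auto simp: Lq_functions_eq)
    then show "g \<in> limits (null_rel s p \<Omega> `` {U})"
      using f g by (auto simp: limits_class_iff[OF U])
  qed
qed

text \<open>Injectivity is where a bound on test functions is not enough by itself: a Cauchy sequence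
  that tends to \<open>0\<close> in \<open>L\<^sup>q\<close> has to tend to \<open>0\<close> in energy. Along a subsequence it tends to \<open>0\<close>
  almost everywhere, so its difference quotients tend to \<open>0\<close> almost everywhere on the product,
  and Fatou's lemma bounds the energies by the Cauchy differences.\<close>

private lemma energy_closable:
  assumes W: "W \<in> cauchy_seqs s p \<Omega>" and lim: "(\<lambda>n. nrm (W n)) \<longlonglongrightarrow> 0"
  shows "(\<lambda>n. gagliardo s p (W n)) \<longlonglongrightarrow> 0"
proof -
  obtain f r where f: "f \<in> Lq_functions q \<Omega>" and r: "strict_mono r"
    and ae: "AE x in lebesgue_on \<Omega>. (\<lambda>k. W (r k) x) \<longlonglongrightarrow> f x"
    and Wf: "(\<lambda>n. nrm (\<lambda>x. W n x - f x)) \<longlonglongrightarrow> 0"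
    by (rule limit_exists[OF W])
  have z: "(\<lambda>x. 0) \<in> Lq_functions q \<Omega>" using in_Lp[OF test_functions_zero] by (simp add: Lq_functions_eq)
  have "f \<in> limits (null_rel s p \<Omega> `` {W})" "(\<lambda>x. 0) \<in> limits (null_rel s p \<Omega> `` {W})"
    using f Wf lim z by (auto simp: limits_class_iff[OF W])
  then have "(\<lambda>x. 0) \<in> ae_rel q \<Omega> `` {f}"
    using limits_class[OF W, of f] by blast
  then have "AE x in lebesgue_on \<Omega>. f x = 0"
    by (simp add: ae_rel_def)
  with ae have "AE x in lebesgue_on \<Omega>. (\<lambda>k. W (r k) x) \<longlonglongrightarrow> 0"
    by eventually_elim simp
  then have "AE x in lebesgue. x \<in> \<Omega> \<longrightarrow> (\<lambda>k. W (r k) x) \<longlonglongrightarrow> 0"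
    using \<Omega> by (subst (asm) AE_restrict_space_iff) auto
  then have "AE x in lborel. x \<in> \<Omega> \<longrightarrow> (\<lambda>k. W (r k) x) \<longlonglongrightarrow> 0"
    by (simp only: AE_completion_iff)
  then have "AE x in lborel. (\<lambda>k. W (r k) x) \<longlonglongrightarrow> 0"
  proof eventually_elim
    case (elim x)
    then show ?case
      using test_function_eq_0[OF cauchy_seqs_test[OF W], of x] by (cases "x \<in> \<Omega>") auto
  qed
  then have "AE z in lborel. (\<lambda>k. W (r k) (fst z)) \<longlonglongrightarrow> 0 \<and> (\<lambda>k. W (r k) (snd z)) \<longlonglongrightarrow> 0"
    by (rule AE_lborel_pair)
  then have ae2: "AE z in lborel. (\<lambda>k. difference_quotient s p (W (r k)) z) \<longlonglongrightarrow> 0"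
  proof eventually_elim
    case (elim z)
    have "(\<lambda>k. (W (r k) (fst z) - W (r k) (snd z)) * (1 / norm (fst z - snd z) powr ((real DIM('a) + s * p) / p)))
        \<longlonglongrightarrow> (0 - 0) * (1 / norm (fst z - snd z) powr ((real DIM('a) + s * p) / p))"
      using elim by (intro tendsto_mult tendsto_diff tendsto_const) auto
    then show ?case by (simp add: difference_quotient_def case_prod_beta)
  qed
  show ?thesis
  proof (rule LIMSEQ_I)
    fix e :: real assume "e > 0"
    then have e2: "e / 2 > 0" by simp
    obtain N where N: "\<And>m n. m \<ge> N \<Longrightarrow> n \<ge> N \<Longrightarrow> G (\<lambda>x. W m x - W n x) < e / 2"
      using cauchy_seqsD[OF W e2] by blast
    have "G (W n) \<le> e / 2" if "n \<ge> N" for n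
    proof -
      have "Lp_seminorm lborel p (\<lambda>z. difference_quotient s p (W n) z - 0) \<le> e / 2"
      proof (rule Lp_Cauchy_Fatou[where F = "\<lambda>n. difference_quotient s p (W n)" and f = "\<lambda>z. 0"
            and N = N and r = r, THEN conjunct2])
        show "difference_quotient s p (W n) \<in> Lp_functions lborel p" for n
          by (rule difference_quotient_in_Lp[OF cauchy_seqs_test[OF W] p s])
        show "Lp_seminorm lborel p (\<lambda>z. difference_quotient s p (W i) z - difference_quotient s p (W j) z) \<le> e / 2"
          if "i \<ge> N" "j \<ge> N" for i j
          using N[OF that] p by (simp add: gagliardo_eq_Lp_seminorm difference_quotient_diff)
      qed (use p \<open>e > 0\<close> that r ae2 in simp_all)
      then show ?thesis using p by (simp add: gagliardo_eq_Lp_seminorm)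
    qed
    then show "\<exists>N. \<forall>n\<ge>N. norm (G (W n) - 0) < e"
      using \<open>e > 0\<close> by (intro exI[of _ N]) force
  qed
qed

lemma inequality_imp_continuously_embedded: "continuously_embedded s p q \<Omega>"
  unfolding continuously_embedded_def
proof (intro exI[of _ limits] conjI ballI allI)
  have D0E: "\<exists>U\<in>cauchy_seqs s p \<Omega>. X = null_rel s p \<Omega> `` {U}" if "X \<in> D0 s p \<Omega>" for X
    using that unfolding D0_def by (auto elim: quotientE)
  have rep: "\<exists>f\<in>Lq_functions q \<Omega>. f \<in> limits (null_rel s p \<Omega> `` {U})" if "U \<in> cauchy_seqs s p \<Omega>" for U
    by (rule limit_exists[OF that]) (auto simp: limits_class_iff[OF that])
  show "limits \<in> D0 s p \<Omega> \<rightarrow> Lq q \<Omega>"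
  proof
    fix X assume "X \<in> D0 s p \<Omega>"
    then obtain U where U: "U \<in> cauchy_seqs s p \<Omega>" "X = null_rel s p \<Omega> `` {U}" using D0E by blast
    then obtain f where f: "f \<in> Lq_functions q \<Omega>" "f \<in> limits X" using rep by blast
    then have "limits X = ae_rel q \<Omega> `` {f}" using limits_class[OF U(1), of f] U(2) by simp
    then show "limits X \<in> Lq q \<Omega>" using f(1) by (simp add: Lq_def quotientI)
  qed
  show "(\<lambda>x. a * f x + b * g x) \<in> limits (null_rel s p \<Omega> `` {\<lambda>n x. a * U n x + b * V n x})"
    if U: "U \<in> cauchy_seqs s p \<Omega>" and V: "V \<in> cauchy_seqs s p \<Omega>"
      and "f \<in> limits (null_rel s p \<Omega> `` {U})" and "g \<in> limits (null_rel s p \<Omega> `` {V})"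
    for U V f g a b
  proof -
    have f: "f \<in> Lp_functions (lebesgue_on \<Omega>) q" "(\<lambda>n. nrm (\<lambda>x. U n x - f x)) \<longlonglongrightarrow> 0"
      and g: "g \<in> Lp_functions (lebesgue_on \<Omega>) q" "(\<lambda>n. nrm (\<lambda>x. V n x - g x)) \<longlonglongrightarrow> 0"
      using that by (auto simp: limits_class_iff Lq_functions_eq)
    have b: "nrm (\<lambda>x. (a * U n x + b * V n x) - (a * f x + b * g x)) \<le>
        \<bar>a\<bar> * nrm (\<lambda>x. U n x - f x) + \<bar>b\<bar> * nrm (\<lambda>x. V n x - g x)" for n
    proof -
      have "nrm (\<lambda>x. (a * U n x + b * V n x) - (a * f x + b * g x)) =
          nrm (\<lambda>x. a * (U n x - f x) + b * (V n x - g x))" by (simp add: algebra_simps)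
      also have "\<dots> \<le> nrm (\<lambda>x. a * (U n x - f x)) + nrm (\<lambda>x. b * (V n x - g x))"
        using q f g in_Lp_cauchy[OF U] in_Lp_cauchy[OF V]
        by (intro Lp_seminorm_triangle Lp_scale Lp_diff) auto
      finally show ?thesis using q by (simp add: Lp_seminorm_scale)
    qed
    have "(\<lambda>n. \<bar>a\<bar> * nrm (\<lambda>x. U n x - f x) + \<bar>b\<bar> * nrm (\<lambda>x. V n x - g x)) \<longlonglongrightarrow> 0"
      using f g by (intro tendsto_add_zero tendsto_mult_right_zero)
    then have "(\<lambda>n. nrm (\<lambda>x. (a * U n x + b * V n x) - (a * f x + b * g x))) \<longlonglongrightarrow> 0"
      by (rule LIMSEQ_0_if_le) (use b in auto)
    then show ?thesis
      using cauchy_seqs_lincomb[OF U V, of a b] f g q by (simp add: limits_class_iff Lq_functions_eq Lp_lincomb)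
  qed
  show "inj_on limits (D0 s p \<Omega>)"
  proof (rule inj_onI)
    fix X Y assume "X \<in> D0 s p \<Omega>" "Y \<in> D0 s p \<Omega>" and eq: "limits X = limits Y"
    then obtain U V where U: "U \<in> cauchy_seqs s p \<Omega>" "X = null_rel s p \<Omega> `` {U}"
      and V: "V \<in> cauchy_seqs s p \<Omega>" "Y = null_rel s p \<Omega> `` {V}" using D0E by metis
    obtain f where "f \<in> limits X" using rep[OF U(1)] U(2) by blast
    then have f: "f \<in> Lp_functions (lebesgue_on \<Omega>) q" "(\<lambda>n. nrm (\<lambda>x. U n x - f x)) \<longlonglongrightarrow> 0"
       "(\<lambda>n. nrm (\<lambda>x. V n x - f x)) \<longlonglongrightarrow> 0"
      using eq limits_class_iff[OF U(1)] limits_class_iff[OF V(1)] U(2) V(2) by (auto simp: Lq_functions_eq)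
    define W where "W = (\<lambda>n x. 1 * U n x + (-1) * V n x)"
    have W: "W \<in> cauchy_seqs s p \<Omega>" unfolding W_def by (rule cauchy_seqs_lincomb[OF U(1) V(1)])
    have Wle: "nrm (W n) \<le> nrm (\<lambda>x. U n x - f x) + nrm (\<lambda>x. V n x - f x)" for n
      using Lp_seminorm_triangle_diff[OF q in_Lp_cauchy[OF U(1)] f(1) in_Lp_cauchy[OF V(1)], of n n]
      by (simp add: W_def Lp_seminorm_minus_commute[of _ _ f])
    have "(\<lambda>n. nrm (\<lambda>x. U n x - f x) + nrm (\<lambda>x. V n x - f x)) \<longlonglongrightarrow> 0"
      using f by (intro tendsto_add_zero)
    then have "(\<lambda>n. nrm (W n)) \<longlonglongrightarrow> 0"
      by (rule LIMSEQ_0_if_le) (use Wle in auto)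
    from energy_closable[OF W this] have "(U, V) \<in> null_rel s p \<Omega>"
      using U V by (simp add: null_rel_def W_def)
    then show "X = Y" using U V equiv_class_eq[OF equiv_null_rel] by simp
  qed
  show "\<exists>C. \<forall>X\<in>D0 s p \<Omega>. Lq_norm q \<Omega> (limits X) \<le> C * D0_norm s p X"
  proof (intro exI[of _ C] ballI)
    fix X assume "X \<in> D0 s p \<Omega>"
    then obtain U where U: "U \<in> cauchy_seqs s p \<Omega>" "X = null_rel s p \<Omega> `` {U}" using D0E by blast
    then obtain f where fX: "f \<in> Lq_functions q \<Omega>" "f \<in> limits X" using rep by blast
    then have f: "f \<in> Lp_functions (lebesgue_on \<Omega>) q" "(\<lambda>n. nrm (\<lambda>x. U n x - f x)) \<longlonglongrightarrow> 0"
      using U limits_class_iff[OF U(1)] by (auto simp: Lq_functions_eq)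
    have "(\<lambda>n. nrm (U n) - nrm f) \<longlonglongrightarrow> 0"
      using Lp_seminorm_reverse_triangle[OF q in_Lp_cauchy[OF U(1)] f(1)]
      by (intro Lim_null_comparison[OF always_eventually f(2)]) auto
    then have "(\<lambda>n. nrm (U n)) \<longlonglongrightarrow> nrm f" by (simp add: LIM_zero_iff)
    moreover have "(\<lambda>n. C * G (U n)) \<longlonglongrightarrow> C * D0_norm s p X"
      unfolding U(2) by (intro tendsto_mult tendsto_const D0_norm_class U)
    ultimately have "nrm f \<le> C * D0_norm s p X"
      using nrm_le[OF cauchy_seqs_test[OF U(1)]] by (intro LIMSEQ_le) auto
    then show "Lq_norm q \<Omega> (limits X) \<le> C * D0_norm s p X"
      using limits_class[OF U(1), of f] fX U(2) Lq_class_norm[OF fX(1)] by simp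
  qed
  show "limits (null_rel s p \<Omega> `` {\<lambda>n. u}) = ae_rel q \<Omega> `` {u}" if u: "u \<in> test_functions \<Omega>" for u
  proof (rule limits_class[OF cauchy_seqs_const[OF u]])
    have "nrm (\<lambda>x. 0) = 0" using q by (simp add: Lp_seminorm_def)
    then show "u \<in> limits (null_rel s p \<Omega> `` {\<lambda>n. u})"
      using in_Lp[OF u] by (simp add: limits_class_iff[OF cauchy_seqs_const[OF u]] Lq_functions_eq)
  qed
qed

end

end

text \<open>Completing both sides of the inequality on test functions costs nothing: the target space is
  complete and the energy is closable, so the identity on test functions extends to an injective
  bounded map of the completions. Conversely constant sequences recover the inequality.\<close>

lemma continuously_embedded_iff_energy_bounds_Lp:
  fixes \<Omega> :: "'a::euclidean_space set"
  assumes "1 < p" "0 < s" "s < 1" "q \<ge> 1" "open \<Omega>"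
  shows "continuously_embedded s p q \<Omega> \<longleftrightarrow> energy_bounds_Lp s p q \<Omega>"
  using continuously_embedded_imp_inequality[of p s q \<Omega>] inequality_imp_continuously_embedded[of p s q \<Omega>] assms
  unfolding energy_bounds_Lp_def by blast

section \<open>From the exponent p to larger subcritical exponents\<close>

lemma energy_bounds_Lp_nonneg:
  assumes "energy_bounds_Lp s p q \<Omega>"
  shows "\<exists>C\<ge>0. \<forall>u\<in>test_functions \<Omega>. Lp_seminorm lborel q u \<le> C * gagliardo s p u"
proof -
  obtain C where C: "\<And>u. u \<in> test_functions \<Omega> \<Longrightarrow> Lp_seminorm lborel q u \<le> C * gagliardo s p u"
    using assms unfolding energy_bounds_Lp_def by blast
  have "Lp_seminorm lborel q u \<le> \<bar>C\<bar> * gagliardo s p u" if "u \<in> test_functions \<Omega>" for u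
    using C[OF that] mult_right_mono[OF abs_ge_self gagliardo_nonneg] by (rule order_trans)
  then show ?thesis by (intro exI[of _ "\<bar>C\<bar>"]) simp
qed

lemma nn_integral_test_function:
  fixes u :: "'a::euclidean_space \<Rightarrow> real"
  assumes u: "u \<in> test_functions \<Omega>" and q: "q > 0"
  shows "(\<integral>\<^sup>+x. ennreal (\<bar>u x\<bar> powr q) \<partial>lborel) = ennreal (Lp_seminorm lborel q u powr q)"
  using q Lp_integrable[OF test_function_in_Lp_lborel[OF u, of q]]
  by (subst nn_integral_eq_integral) (auto simp: integral_eq_Lp_seminorm_powr)

text \<open>A point where \<open>\<bar>u\<bar> = t\<close> sees many points where \<open>\<bar>u\<bar> < t / 2\<close>: by Markov's inequality the
  set \<open>\<bar>u\<bar> \<ge> t / 2\<close> has measure at most \<open>m = (2 / t)\<^sup>a A\<close>, hence fills at most half of a ball of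
  volume \<open>2 m\<close>. The other half contributes at least
  \<open>(t / 2)\<^sup>p r\<^sup>-\<^sup>N\<^sup>-\<^sup>s\<^sup>p m\<close> to the inner integral, where \<open>r\<close> is the radius of that ball.\<close>

lemma kernel_integral_lower_bound:
  fixes u :: "'a::euclidean_space \<Rightarrow> real" and s p a A :: real
  defines "N \<equiv> real DIM('a)" and "w \<equiv> unit_ball_vol (real DIM('a))"
  assumes u[measurable]: "u \<in> borel_measurable borel" and p: "p > 0" and s: "s > 0" and a: "a > 0"
    and A: "(\<integral>\<^sup>+y. ennreal (\<bar>u y\<bar> powr a) \<partial>lborel) = ennreal A" "A > 0"
  shows "ennreal (\<bar>u x\<bar> powr (p + s * p / N * a)) \<le>
    ennreal (2 / w * 2 powr p * (2 / w * 2 powr a) powr (s * p / N) * A powr (s * p / N)) *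
    (\<integral>\<^sup>+y. ennreal (gagliardo_kernel s p u x y) \<partial>lborel)"
proof (cases "u x = 0")
  case True
  then show ?thesis by simp
next
  case False
  define t where "t = \<bar>u x\<bar>"
  have t: "t > 0" using False by (simp add: t_def)
  have N: "N > 0" and w: "w > 0" by (auto simp: N_def w_def)
  define m where "m = (2 / t) powr a * A"
  have m: "m > 0" using t A by (simp add: m_def)
  \<comment> \<open>the radius of a ball of volume \<open>2 * m\<close>\<close>
  define r where "r = (2 * m / w) powr (1 / N)"
  have r: "r > 0" using m w by (simp add: r_def)
  have rN: "w * r powr N = 2 * m" using m w N by (simp add: r_def powr_powr)
  define S where "S = {y. \<bar>u y\<bar> \<ge> t / 2}"
  define B where "B = ball x r"
  have [measurable]: "S \<in> sets borel" "B \<in> sets borel" unfolding S_def B_def by measurable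
  have S: "emeasure lborel S \<le> ennreal m"
  proof -
    have "emeasure lborel S = (\<integral>\<^sup>+y. indicator S y \<partial>lborel)" by simp
    also have "\<dots> \<le> (\<integral>\<^sup>+y. ennreal ((2 / t) powr a) * ennreal (\<bar>u y\<bar> powr a) \<partial>lborel)"
    proof (intro nn_integral_mono)
      fix y
      show "indicator S y \<le> ennreal ((2 / t) powr a) * ennreal (\<bar>u y\<bar> powr a)"
      proof (cases "y \<in> S")
        case True
        then have "1 \<le> 2 / t * \<bar>u y\<bar>" using t by (simp add: S_def field_simps)
        then have "1 \<le> (2 / t * \<bar>u y\<bar>) powr a" using a by (intro ge_one_powr_ge_zero) auto
        then have "1 \<le> (2 / t) powr a * \<bar>u y\<bar> powr a" using t by (subst (asm) powr_mult) auto
        then show ?thesis using True by (simp add: ennreal_mult[symmetric])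
      qed simp
    qed
    also have "\<dots> = ennreal m" using A by (simp add: nn_integral_cmult m_def ennreal_mult)
    finally show ?thesis .
  qed
  have half: "ennreal m \<le> emeasure lborel (B - S)"
  proof -
    have "emeasure lborel B = ennreal (w * r powr N)"
      using r unfolding B_def by (subst emeasure_ball) (auto simp: w_def N_def powr_realpow)
    then have "ennreal m + ennreal m = emeasure lborel B"
      using m rN by (simp add: ennreal_plus[symmetric] del: ennreal_plus)
    also have "\<dots> \<le> emeasure lborel ((B - S) \<union> S)" by (intro emeasure_mono) auto
    also have "\<dots> \<le> emeasure lborel (B - S) + emeasure lborel S"
      by (intro emeasure_subadditive) auto
    also have "\<dots> \<le> emeasure lborel (B - S) + ennreal m" using S by (intro add_left_mono)
    finally show ?thesis by (simp add: ennreal_add_left_cancel_le add.commute)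
  qed
  define c where "c = (t / 2) powr p / r powr (N + s * p)"
  have c: "c \<ge> 0" by (simp add: c_def)
  have "ennreal (c * m) = ennreal c * ennreal m" using c m by (simp add: ennreal_mult)
  also have "\<dots> \<le> ennreal c * emeasure lborel (B - S)" by (intro mult_left_mono half) simp
  also have "\<dots> = (\<integral>\<^sup>+y. ennreal c * indicator (B - S) y \<partial>lborel)"
    by (simp add: nn_integral_cmult)
  also have "\<dots> \<le> (\<integral>\<^sup>+y. ennreal (gagliardo_kernel s p u x y) \<partial>lborel)"
  proof (intro nn_integral_mono)
    fix y
    show "ennreal c * indicator (B - S) y \<le> ennreal (gagliardo_kernel s p u x y)"
    proof (cases "y \<in> B - S")
      case True
      then have y: "norm (x - y) < r" "\<bar>u y\<bar> < t / 2" by (auto simp: B_def S_def dist_norm)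
      then have "x \<noteq> y" using t by (auto simp: t_def)
      moreover have "t / 2 \<le> \<bar>u x - u y\<bar>" using y(2) unfolding t_def by linarith
      ultimately have "c \<le> gagliardo_kernel s p u x y"
        unfolding c_def gagliardo_kernel_def N_def using y t s p
        by (intro frac_le powr_mono2) (auto simp: N_def)
      then show ?thesis using True by (simp add: ennreal_leI)
    qed simp
  qed
  finally have lower: "ennreal (c * m) \<le> (\<integral>\<^sup>+y. ennreal (gagliardo_kernel s p u x y) \<partial>lborel)" .
  define \<sigma> where "\<sigma> = s * p / N"
  have rs: "r powr (s * p) = (2 / w * 2 powr a) powr \<sigma> * t powr (- (a * \<sigma>)) * A powr \<sigma>"
  proof -
    have "r powr (s * p) = (2 * m / w) powr \<sigma>" by (simp add: r_def powr_powr \<sigma>_def)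
    also have "2 * m / w = (2 / w * 2 powr a) * (t powr (- a) * A)"
      using t by (simp add: m_def powr_divide powr_minus_divide field_simps)
    also have "\<dots> powr \<sigma> = (2 / w * 2 powr a) powr \<sigma> * (t powr (- (a * \<sigma>)) * A powr \<sigma>)"
      by (simp only: powr_mult powr_powr minus_mult_left)
    finally show ?thesis by simp
  qed
  have "t powr (p + \<sigma> * a) = 2 / w * 2 powr p * (2 / w * 2 powr a) powr \<sigma> * A powr \<sigma> * (c * m)"
  proof -
    have m': "m = w * r powr N / 2" using rN by simp
    have pos: "(2 / w * 2 powr a) powr \<sigma> > 0" "A powr \<sigma> > 0" "r powr N > 0"
      using w A r by auto
    have cm: "c * m = w / 2 * (t powr p / 2 powr p) * (t powr (a * \<sigma>) / ((2 / w * 2 powr a) powr \<sigma> * A powr \<sigma>))"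
      unfolding c_def m' powr_add rs using pos by (simp add: powr_divide powr_minus field_simps)
    show ?thesis unfolding cm using pos w by (simp add: powr_add mult.commute[of \<sigma> a])
  qed
  then have "ennreal (t powr (p + \<sigma> * a)) =
      ennreal (2 / w * 2 powr p * (2 / w * 2 powr a) powr \<sigma> * A powr \<sigma>) * ennreal (c * m)"
    using w c m by (subst ennreal_mult[symmetric]) auto
  also have "\<dots> \<le> ennreal (2 / w * 2 powr p * (2 / w * 2 powr a) powr \<sigma> * A powr \<sigma>) *
      (\<integral>\<^sup>+y. ennreal (gagliardo_kernel s p u x y) \<partial>lborel)"
    by (intro mult_left_mono lower) simp
  finally show ?thesis by (simp add: t_def \<sigma>_def)
qed

text \<open>Integrating the pointwise lower bound over \<open>x\<close> gives
  \<open>\<integral> \<bar>u\<bar>\<^sup>b \<le> K (\<integral> \<bar>u\<bar>\<^sup>a)\<^sup>\<sigma> [u]\<^sup>p\<close> with \<open>\<sigma> = s p / N\<close> and \<open>b = p + \<sigma> a\<close>.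
  The power of \<open>A = \<integral> \<bar>u\<bar>\<^sup>a\<close> in that bound requires \<open>A > 0\<close>; otherwise \<open>u\<close> vanishes almost
  everywhere.\<close>

lemma gagliardo_nirenberg_step:
  fixes \<Omega> :: "'a::euclidean_space set" and s p a :: real
  assumes p: "1 < p" and s: "0 < s" "s < 1" and a: "a > 0"
  shows "\<exists>K\<ge>0. \<forall>u\<in>test_functions \<Omega>.
    Lp_seminorm lborel (p + s * p / DIM('a) * a) u powr (p + s * p / DIM('a) * a)
      \<le> K * (Lp_seminorm lborel a u powr a) powr (s * p / DIM('a)) * gagliardo s p u powr p"
proof -
  define \<sigma> where "\<sigma> = s * p / DIM('a)"
  define w where "w = unit_ball_vol (real DIM('a))"
  define K where "K = 2 / w * 2 powr p * (2 / w * 2 powr a) powr \<sigma>"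
  have w: "w > 0" by (simp add: w_def)
  have K: "K \<ge> 0" using w by (simp add: K_def)
  have \<sigma>: "\<sigma> > 0" using p s by (simp add: \<sigma>_def)
  define b where "b = p + \<sigma> * a"
  have b: "b > 0" unfolding b_def using p \<sigma> a by (intro add_pos_pos mult_pos_pos) auto
  have "Lp_seminorm lborel b u powr b \<le> K * (Lp_seminorm lborel a u powr a) powr \<sigma> * gagliardo s p u powr p"
    if u: "u \<in> test_functions \<Omega>" for u
  proof -
    note [measurable] = u
    define A where "A = Lp_seminorm lborel a u powr a"
    have A: "(\<integral>\<^sup>+y. ennreal (\<bar>u y\<bar> powr a) \<partial>lborel) = ennreal A"
      unfolding A_def by (rule nn_integral_test_function[OF u a])
    show ?thesis
    proof (cases "A > 0")
      case False
      then have "Lp_seminorm lborel a u = 0" using Lp_seminorm_nonneg[of lborel a u] by (auto simp: A_def)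
      then have "AE x in lborel. u x = 0"
        using a test_function_in_Lp_lborel[OF u] by (subst (asm) Lp_seminorm_eq_0_iff) auto
      then have "Lp_seminorm lborel b u = 0"
        using b test_function_in_Lp_lborel[OF u] by (subst Lp_seminorm_eq_0_iff) auto
      then show ?thesis using K by simp
    next
      case True
      have "ennreal (Lp_seminorm lborel b u powr b) = (\<integral>\<^sup>+x. ennreal (\<bar>u x\<bar> powr b) \<partial>lborel)"
        using b by (simp add: nn_integral_test_function[OF u])
      also have "\<dots> \<le> (\<integral>\<^sup>+x. ennreal (K * A powr \<sigma>) * (\<integral>\<^sup>+y. ennreal (gagliardo_kernel s p u x y) \<partial>lborel) \<partial>lborel)"
        unfolding b_def \<sigma>_def K_def w_def using p s a A True
        by (intro nn_integral_mono kernel_integral_lower_bound) auto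
      also have "\<dots> = ennreal (K * A powr \<sigma>) * gagliardo_energy s p u"
        unfolding gagliardo_energy_def by (subst nn_integral_cmult) auto
      also have "\<dots> = ennreal (K * A powr \<sigma> * gagliardo s p u powr p)"
        using K by (simp add: gagliardo_energy_eq[OF u p s] ennreal_mult)
      finally show ?thesis unfolding A_def using K by (subst (asm) ennreal_le_iff) auto
    qed
  qed
  then show ?thesis unfolding b_def \<sigma>_def using K by blast
qed

text \<open>Both sides of the step inequality have the same degree of homogeneity \<open>p + \<sigma> a\<close> once
  \<open>\<integral> \<bar>u\<bar>\<^sup>a\<close> is replaced by its bound \<open>(C [u])\<^sup>a\<close>, so the bound passes from \<open>L\<^sup>a\<close> to \<open>L\<^sup>b\<close> with
  \<open>b = p + \<sigma> a\<close>.\<close>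

lemma energy_bounds_Lp_step:
  fixes \<Omega> :: "'a::euclidean_space set" and s p a :: real
  assumes p: "1 < p" and s: "0 < s" "s < 1" and a: "a > 0" and E: "energy_bounds_Lp s p a \<Omega>"
  shows "energy_bounds_Lp s p (p + s * p / DIM('a) * a) \<Omega>"
proof -
  define \<sigma> where "\<sigma> = s * p / DIM('a)"
  have \<sigma>: "\<sigma> > 0" using p s by (simp add: \<sigma>_def)
  define b where "b = p + \<sigma> * a"
  have b: "b > 0" unfolding b_def using p \<sigma> a by (intro add_pos_pos mult_pos_pos) auto
  obtain K where K: "K \<ge> 0" "\<And>u. u \<in> test_functions \<Omega> \<Longrightarrow>
      Lp_seminorm lborel b u powr b \<le> K * (Lp_seminorm lborel a u powr a) powr \<sigma> * gagliardo s p u powr p"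
    using gagliardo_nirenberg_step[OF p s a, of \<Omega>] unfolding b_def \<sigma>_def by blast
  obtain C where C: "C \<ge> 0" "\<And>u. u \<in> test_functions \<Omega> \<Longrightarrow> Lp_seminorm lborel a u \<le> C * gagliardo s p u"
    using energy_bounds_Lp_nonneg[OF E] by blast
  define D where "D = K * C powr (a * \<sigma>)"
  have D: "D \<ge> 0" using K by (simp add: D_def)
  have "Lp_seminorm lborel b u \<le> D powr (1 / b) * gagliardo s p u" if u: "u \<in> test_functions \<Omega>" for u
  proof -
    define g where "g = gagliardo s p u"
    have g: "g \<ge> 0" by (simp add: g_def)
    have "(Lp_seminorm lborel a u powr a) powr \<sigma> = Lp_seminorm lborel a u powr (a * \<sigma>)" by (rule powr_powr)
    also have "\<dots> \<le> (C * g) powr (a * \<sigma>)"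
      unfolding g_def using C(2)[OF u] a \<sigma> by (intro powr_mono2) auto
    finally have Ca: "(Lp_seminorm lborel a u powr a) powr \<sigma> \<le> (C * g) powr (a * \<sigma>)" .
    have "Lp_seminorm lborel b u powr b \<le> K * (Lp_seminorm lborel a u powr a) powr \<sigma> * g powr p"
      unfolding g_def by (rule K(2)[OF u])
    also have "\<dots> \<le> K * (C * g) powr (a * \<sigma>) * g powr p"
      using K(1) by (intro mult_right_mono mult_left_mono Ca) auto
    also have "\<dots> = D * g powr b"
      using C g by (simp add: D_def b_def powr_mult powr_add algebra_simps)
    also have "\<dots> = (D powr (1 / b) * g) powr b"
      using D g b by (simp add: powr_mult powr_powr)
    finally have "Lp_seminorm lborel b u powr b \<le> (D powr (1 / b) * g) powr b" .
    then show ?thesis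
      using b g by (subst Lp_seminorm_le_iff) (auto simp: integral_eq_Lp_seminorm_powr g_def)
  qed
  then show ?thesis unfolding energy_bounds_Lp_def b_def \<sigma>_def by blast
qed

text \<open>After normalising by the energy, \<open>h\<^sup>q \<le> h\<^sup>a + h\<^sup>b\<close> holds pointwise for \<open>a < q < b\<close>, which
  stands in for the interpolation inequality of the \<open>L\<^sup>p\<close> scale.\<close>

lemma energy_bounds_Lp_interpolate:
  fixes \<Omega> :: "'a::euclidean_space set"
  assumes p: "1 < p" and s: "0 < s" "s < 1" and q: "0 < a" "a < q" "q < b"
    and Ea: "energy_bounds_Lp s p a \<Omega>" and Eb: "energy_bounds_Lp s p b \<Omega>"
  shows "energy_bounds_Lp s p q \<Omega>"
proof -
  obtain C1 where C1: "C1 \<ge> 0" "\<And>u. u \<in> test_functions \<Omega> \<Longrightarrow> Lp_seminorm lborel a u \<le> C1 * gagliardo s p u"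
    using energy_bounds_Lp_nonneg[OF Ea] by blast
  obtain C2 where C2: "C2 \<ge> 0" "\<And>u. u \<in> test_functions \<Omega> \<Longrightarrow> Lp_seminorm lborel b u \<le> C2 * gagliardo s p u"
    using energy_bounds_Lp_nonneg[OF Eb] by blast
  define D where "D = C1 powr a + C2 powr b"
  have D: "D \<ge> 0" by (simp add: D_def)
  have "Lp_seminorm lborel q u \<le> D powr (1 / q) * gagliardo s p u" if u: "u \<in> test_functions \<Omega>" for u
  proof -
    note L = test_function_in_Lp_lborel[OF u]
    define g where "g = gagliardo s p u"
    have g0: "g \<ge> 0" by (simp add: g_def)
    show ?thesis
    proof (cases "g = 0")
      case True
      then have "Lp_seminorm lborel a u = 0"
        using C1(2)[OF u] Lp_seminorm_nonneg[of lborel a u] by (simp add: g_def)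
      then have "AE x in lborel. u x = 0"
        using q L by (subst (asm) Lp_seminorm_eq_0_iff) auto
      then have "Lp_seminorm lborel q u = 0"
        using q L by (subst Lp_seminorm_eq_0_iff) auto
      then show ?thesis by simp
    next
      case False
      with g0 have g: "g > 0" by simp
      have norm_le: "(\<integral>x. \<bar>u x\<bar> powr c \<partial>lborel) / g powr c \<le> C powr c"
        if "c > 0" "C \<ge> 0" "Lp_seminorm lborel c u \<le> C * gagliardo s p u" for c C
        using that g powr_mono2[of c "Lp_seminorm lborel c u" "C * g"]
        by (simp add: integral_eq_Lp_seminorm_powr g_def powr_mult field_simps)
      have "(\<integral>x. \<bar>u x\<bar> powr q \<partial>lborel) \<le>
          (\<integral>x. g powr q * (\<bar>u x\<bar> powr a / g powr a + \<bar>u x\<bar> powr b / g powr b) \<partial>lborel)"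
      proof (rule integral_mono)
        show "integrable lborel (\<lambda>x. \<bar>u x\<bar> powr q)"
          "integrable lborel (\<lambda>x. g powr q * (\<bar>u x\<bar> powr a / g powr a + \<bar>u x\<bar> powr b / g powr b))"
          using q by (intro integrable_mult_right Bochner_Integration.integrable_add integrable_divide Lp_integrable L; simp)+
        fix x
        define h where "h = \<bar>u x\<bar> / g"
        have h: "h \<ge> 0" using g by (simp add: h_def)
        have "h powr q \<le> h powr a + h powr b"
        proof (cases "h \<ge> 1")
          case True
          then have "h powr q \<le> h powr b" using q by (intro powr_mono) auto
          then show ?thesis by (simp add: add_increasing)
        next
          case False
          then have "h powr q \<le> h powr a" using q h by (intro powr_mono') auto
          then show ?thesis by (simp add: add_increasing2)
        qed
        then have "g powr q * h powr q \<le> g powr q * (h powr a + h powr b)" by (intro mult_left_mono) auto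
        then show "\<bar>u x\<bar> powr q \<le> g powr q * (\<bar>u x\<bar> powr a / g powr a + \<bar>u x\<bar> powr b / g powr b)"
          using g by (simp add: h_def powr_divide)
      qed
      also have "\<dots> = g powr q * ((\<integral>x. \<bar>u x\<bar> powr a \<partial>lborel) / g powr a + (\<integral>x. \<bar>u x\<bar> powr b \<partial>lborel) / g powr b)"
        using q L by (simp add: Lp_integrable)
      also have "\<dots> \<le> g powr q * D"
        unfolding D_def using q C1 C2 u by (intro mult_left_mono add_mono norm_le) auto
      also have "\<dots> = (D powr (1 / q) * g) powr q"
        using D g q by (simp add: powr_mult powr_powr)
      finally show ?thesis
        using q g by (subst Lp_seminorm_le_iff) (auto simp: g_def)
    qed
  qed
  then show ?thesis unfolding energy_bounds_Lp_def by blast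
qed

text \<open>The exponents reached by iterating the step from \<open>L\<^sup>p\<close>. They are the partial sums of
  \<open>p (1 + \<sigma> + \<sigma>\<^sup>2 + \<dots>)\<close>, and for \<open>\<sigma> = s p / N\<close> the sum of this series is the critical
  exponent.\<close>

primrec sobolev_exponents :: "real \<Rightarrow> real \<Rightarrow> nat \<Rightarrow> real" where
  "sobolev_exponents \<sigma> p 0 = p"
| "sobolev_exponents \<sigma> p (Suc k) = p + \<sigma> * sobolev_exponents \<sigma> p k"

lemma sobolev_exponents_ge:
  assumes "\<sigma> \<ge> 0" "p \<ge> 0" shows "sobolev_exponents \<sigma> p k \<ge> p"
proof (induction k)
  case (Suc k)
  then show ?case using assms mult_nonneg_nonneg[of \<sigma> "sobolev_exponents \<sigma> p k"] by simp
qed simp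

text \<open>For \<open>\<sigma> < 1\<close> the exponents converge geometrically to the fixed point \<open>L = p / (1 - \<sigma>)\<close> of the
  recursion, which is the critical exponent; for \<open>\<sigma> \<ge> 1\<close> they grow at least linearly.\<close>

lemma sobolev_exponents_exceed:
  fixes s p q :: real
  assumes p: "1 < p" and s: "0 < s" and q: "ereal q < critical_exponent N s p" and N: "N > 0"
  shows "\<exists>k. q < sobolev_exponents (s * p / N) p k"
proof -
  define \<sigma> where "\<sigma> = s * p / N"
  have \<sigma>: "\<sigma> > 0" using p s N by (simp add: \<sigma>_def)
  show ?thesis
  proof (cases "s * p < real N")
    case True
    then have \<sigma>1: "\<sigma> < 1" using N by (simp add: \<sigma>_def)
    define L where "L = p / (1 - \<sigma>)"
    have "L = real N * p / (real N - s * p)"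
      using N True by (simp add: L_def \<sigma>_def field_simps)
    then have qL: "q < L" using q True by (simp add: critical_exponent_def)
    have fixpoint: "p + \<sigma> * L = L" using \<sigma>1 by (simp add: L_def field_simps)
    have eq: "sobolev_exponents \<sigma> p k = L - \<sigma> ^ Suc k * L" for k
    proof (induction k)
      case 0
      then show ?case using fixpoint by simp
    next
      case (Suc k)
      have "sobolev_exponents \<sigma> p (Suc k) = (p + \<sigma> * L) - \<sigma> ^ Suc (Suc k) * L"
        by (simp add: Suc algebra_simps)
      then show ?case unfolding fixpoint .
    qed
    have "(\<lambda>k. L - \<sigma> ^ Suc k * L) \<longlonglongrightarrow> L - 0 * L"
      using \<sigma> \<sigma>1 by (intro tendsto_intros LIMSEQ_Suc LIMSEQ_realpow_zero) auto
    then have "\<forall>\<^sub>F k in sequentially. q < sobolev_exponents \<sigma> p k"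
      unfolding eq using qL by (intro order_tendstoD) auto
    then show ?thesis unfolding \<sigma>_def eventually_sequentially by blast
  next
    case False
    then have \<sigma>1: "\<sigma> \<ge> 1" using N by (simp add: \<sigma>_def)
    have ge: "sobolev_exponents \<sigma> p k \<ge> real (Suc k) * p" for k
    proof (induction k)
      case (Suc k)
      have "1 * (real (Suc k) * p) \<le> \<sigma> * sobolev_exponents \<sigma> p k"
        using Suc \<sigma>1 p by (intro mult_mono) auto
      then show ?case by (simp add: algebra_simps)
    qed simp
    obtain k where "q < real k * p" using p reals_Archimedean3[of p] by auto
    also have "\<dots> \<le> real (Suc k) * p" using p by simp
    also have "\<dots> \<le> sobolev_exponents \<sigma> p k" by (rule ge)
    finally show ?thesis unfolding \<sigma>_def by blast
  qed
qed

lemma energy_bounds_Lp_subcritical: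
  fixes \<Omega> :: "'a::euclidean_space set"
  assumes p: "1 < p" and s: "0 < s" "s < 1" and q: "p < q" "ereal q < critical_exponent DIM('a) s p"
    and E: "energy_bounds_Lp s p p \<Omega>"
  shows "energy_bounds_Lp s p q \<Omega>"
proof -
  let ?e = "sobolev_exponents (s * p / DIM('a)) p"
  have "energy_bounds_Lp s p (?e k) \<Omega>" for k
  proof (induction k)
    case (Suc k)
    have "?e k > 0" using sobolev_exponents_ge[of "s * p / DIM('a)" p k] p s by simp
    then show ?case using energy_bounds_Lp_step[OF p s _ Suc] by simp
  qed (simp add: E)
  moreover obtain k where "q < ?e k" using sobolev_exponents_exceed[OF p s(1) q(2)] by auto
  ultimately show ?thesis
    using energy_bounds_Lp_interpolate[OF p s _ q(1) _ E] p by auto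
qed

section \<open>From a larger subcritical exponent back to p\<close>

text \<open>On a set of measure at most \<open>V\<close> the higher norm controls the lower one. Where \<open>\<bar>v\<bar> \<le> \<mu>\<close> use
  \<open>\<bar>v\<bar>\<^sup>p \<le> \<mu>\<^sup>p\<close>, elsewhere \<open>\<bar>v\<bar>\<^sup>p \<le> \<mu>\<^sup>p\<^sup>-\<^sup>q \<bar>v\<bar>\<^sup>q\<close>; the level \<open>\<mu>\<close> is the one that balances the
  two contributions. This costs only the factor \<open>2\<close> compared with Hoelder's inequality.\<close>

lemma Lp_seminorm_le_on_support:
  fixes v :: "'a::euclidean_space \<Rightarrow> real"
  assumes v: "v \<in> test_functions \<Omega>" and pq: "0 < p" "p < q"
    and B: "B \<in> sets borel" "\<And>x. v x \<noteq> 0 \<Longrightarrow> x \<in> B" and V: "emeasure lborel B \<le> ennreal V" "V > 0"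
  shows "Lp_seminorm lborel p v powr p \<le> 2 * V powr (1 - p / q) * Lp_seminorm lborel q v powr p"
proof (cases "Lp_seminorm lborel q v = 0")
  case True
  then have "AE x in lborel. v x = 0"
    using pq test_function_in_Lp_lborel[OF v] by (subst (asm) Lp_seminorm_eq_0_iff) auto
  then have "Lp_seminorm lborel p v = 0"
    using pq test_function_in_Lp_lborel[OF v] by (subst Lp_seminorm_eq_0_iff) auto
  then show ?thesis by simp
next
  case False
  note [measurable] = v B(1)
  define Y where "Y = Lp_seminorm lborel q v"
  have Y: "Y > 0" using False Lp_seminorm_nonneg[of lborel q v] by (simp add: Y_def less_le)
  define \<mu> where "\<mu> = Y / V powr (1 / q)"
  have \<mu>: "\<mu> > 0" using Y V by (simp add: \<mu>_def)
  have le: "\<bar>v x\<bar> powr p \<le> \<mu> powr p * indicator B x + \<mu> powr (p - q) * \<bar>v x\<bar> powr q" for x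
  proof (cases "\<bar>v x\<bar> \<le> \<mu>")
    case True
    then have "\<bar>v x\<bar> powr p \<le> \<mu> powr p * indicator B x"
      using B(2)[of x] pq by (cases "v x = 0") (auto intro: powr_mono2)
    then show ?thesis by (simp add: add_increasing2)
  next
    case False
    have "\<bar>v x\<bar> powr p = \<bar>v x\<bar> powr (p - q) * \<bar>v x\<bar> powr q"
      by (simp flip: powr_add)
    also have "\<dots> \<le> \<mu> powr (p - q) * \<bar>v x\<bar> powr q"
      using False \<mu> pq by (intro mult_right_mono powr_mono2') auto
    finally show ?thesis by (simp add: add_increasing)
  qed
  have "ennreal (Lp_seminorm lborel p v powr p) = (\<integral>\<^sup>+x. ennreal (\<bar>v x\<bar> powr p) \<partial>lborel)"
    using pq by (simp add: nn_integral_test_function[OF v])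
  also have "\<dots> \<le> (\<integral>\<^sup>+x. ennreal (\<mu> powr p) * indicator B x + ennreal (\<mu> powr (p - q)) * ennreal (\<bar>v x\<bar> powr q) \<partial>lborel)"
  proof (intro nn_integral_mono)
    fix x
    have "ennreal (\<bar>v x\<bar> powr p) \<le> ennreal (\<mu> powr p * indicator B x + \<mu> powr (p - q) * \<bar>v x\<bar> powr q)"
      by (intro ennreal_leI le)
    then show "ennreal (\<bar>v x\<bar> powr p) \<le> ennreal (\<mu> powr p) * indicator B x + ennreal (\<mu> powr (p - q)) * ennreal (\<bar>v x\<bar> powr q)"
      by (simp add: ennreal_plus ennreal_mult ennreal_indicator)
  qed
  also have "\<dots> = ennreal (\<mu> powr p) * emeasure lborel B + ennreal (\<mu> powr (p - q)) * ennreal (Y powr q)"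
    using pq nn_integral_test_function[OF v, of q] by (simp add: nn_integral_add nn_integral_cmult Y_def)
  also have "\<dots> \<le> ennreal (\<mu> powr p) * ennreal V + ennreal (\<mu> powr (p - q)) * ennreal (Y powr q)"
    using V by (intro add_right_mono mult_left_mono) auto
  also have "\<dots> = ennreal (\<mu> powr p * V + \<mu> powr (p - q) * Y powr q)"
    using V by (simp add: ennreal_mult ennreal_plus)
  finally have "Lp_seminorm lborel p v powr p \<le> \<mu> powr p * V + \<mu> powr (p - q) * Y powr q"
    using V by (subst (asm) ennreal_le_iff) auto
  also have "\<mu> powr p * V = V powr (1 - p / q) * Y powr p"
    using V by (simp add: \<mu>_def powr_divide powr_powr powr_diff)
  also have "\<mu> powr (p - q) * Y powr q = V powr (1 - p / q) * Y powr p"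
    using V Y pq by (simp add: \<mu>_def powr_divide powr_powr powr_diff diff_divide_distrib)
  finally show ?thesis by (simp add: Y_def mult_ac)
qed

lemma nn_integral_translated_product:
  fixes f g :: "'a::euclidean_space \<Rightarrow> ennreal"
  assumes [measurable]: "f \<in> borel_measurable borel" "g \<in> borel_measurable borel"
  shows "(\<integral>\<^sup>+z. \<integral>\<^sup>+x. g (r *\<^sub>R x - z) * f x \<partial>lborel \<partial>lborel) = (\<integral>\<^sup>+z. g z \<partial>lborel) * (\<integral>\<^sup>+x. f x \<partial>lborel)"
proof -
  have "(\<integral>\<^sup>+z. \<integral>\<^sup>+x. g (r *\<^sub>R x - z) * f x \<partial>lborel \<partial>lborel) = (\<integral>\<^sup>+x. \<integral>\<^sup>+z. g (r *\<^sub>R x - z) * f x \<partial>lborel \<partial>lborel)"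
    by (rule nn_integral_lborel_swap) measurable
  also have "\<dots> = (\<integral>\<^sup>+x. (\<integral>\<^sup>+z. g z \<partial>lborel) * f x \<partial>lborel)"
    by (simp add: nn_integral_multc nn_integral_lborel_reflect)
  finally show ?thesis by (simp add: nn_integral_cmult)
qed

text \<open>Averaging over the translation \<open>z\<close> leaves a function of \<open>x - y\<close> alone, and the substitution
  \<open>x = y + R h\<close> then shows how the energy of the cutoff scales: \<open>R\<^sup>N\<close> from the volume element
  times \<open>R\<^sup>-\<^sup>N\<^sup>-\<^sup>s\<^sup>p\<close> from the kernel. The second point \<open>y\<close> stays fixed because the factor
  \<open>\<bar>u y\<bar>\<^sup>p\<close> will be integrated against this identity.\<close>

lemma averaged_rescaled_energy:
  fixes \<phi> :: "'a::euclidean_space \<Rightarrow> real"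
  assumes \<phi>[measurable]: "\<phi> \<in> borel_measurable borel" and R: "R > 0"
  shows "(\<integral>\<^sup>+x. \<integral>\<^sup>+z. ennreal (\<bar>\<phi> ((1 / R) *\<^sub>R x - z) - \<phi> ((1 / R) *\<^sub>R y - z)\<bar> powr p /
        norm (x - y) powr (real DIM('a) + s * p)) \<partial>lborel \<partial>lborel)
    = ennreal (R powr - (s * p)) * gagliardo_energy s p \<phi>"
proof -
  define M where "M = real DIM('a) + s * p"
  have "(\<integral>\<^sup>+z. ennreal (\<bar>\<phi> ((1 / R) *\<^sub>R x - z) - \<phi> ((1 / R) *\<^sub>R y - z)\<bar> powr p / norm (x - y) powr M) \<partial>lborel)
      = (\<integral>\<^sup>+w. ennreal (\<bar>\<phi> ((1 / R) *\<^sub>R (x - y) + w) - \<phi> w\<bar> powr p / norm (x - y) powr M) \<partial>lborel)" for x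
    using nn_integral_lborel_reflect[of "\<lambda>w. ennreal (\<bar>\<phi> ((1 / R) *\<^sub>R (x - y) + w) - \<phi> w\<bar> powr p / norm (x - y) powr M)" "(1 / R) *\<^sub>R y"]
    by (simp add: scaleR_diff_right algebra_simps)
  then have "(\<integral>\<^sup>+x. \<integral>\<^sup>+z. ennreal (\<bar>\<phi> ((1 / R) *\<^sub>R x - z) - \<phi> ((1 / R) *\<^sub>R y - z)\<bar> powr p / norm (x - y) powr M) \<partial>lborel \<partial>lborel)
     = (\<integral>\<^sup>+x. \<integral>\<^sup>+w. ennreal (\<bar>\<phi> ((1 / R) *\<^sub>R (x - y) + w) - \<phi> w\<bar> powr p / norm (x - y) powr M) \<partial>lborel \<partial>lborel)"
    by simp
  also have "\<dots> = ennreal (R ^ DIM('a)) *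
      (\<integral>\<^sup>+h. \<integral>\<^sup>+w. ennreal (\<bar>\<phi> (h + w) - \<phi> w\<bar> powr p / norm (R *\<^sub>R h) powr M) \<partial>lborel \<partial>lborel)"
    using R by (subst nn_integral_lborel_affine[where c = R and t = y]) auto
  also have "(\<integral>\<^sup>+h. \<integral>\<^sup>+w. ennreal (\<bar>\<phi> (h + w) - \<phi> w\<bar> powr p / norm (R *\<^sub>R h) powr M) \<partial>lborel \<partial>lborel) =
      (\<integral>\<^sup>+h. \<integral>\<^sup>+w. ennreal (R powr - M) * ennreal (\<bar>\<phi> (h + w) - \<phi> w\<bar> powr p / norm h powr M) \<partial>lborel \<partial>lborel)"
    using R by (simp add: powr_mult powr_minus_divide ennreal_mult[symmetric])
  also have "\<dots> = ennreal (R powr - M) *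
      (\<integral>\<^sup>+h. \<integral>\<^sup>+w. ennreal (\<bar>\<phi> (h + w) - \<phi> w\<bar> powr p / norm h powr M) \<partial>lborel \<partial>lborel)"
    by (simp add: nn_integral_cmult)
  also have "(\<integral>\<^sup>+h. \<integral>\<^sup>+w. ennreal (\<bar>\<phi> (h + w) - \<phi> w\<bar> powr p / norm h powr M) \<partial>lborel \<partial>lborel) =
      (\<integral>\<^sup>+w. \<integral>\<^sup>+h. ennreal (\<bar>\<phi> (h + w) - \<phi> w\<bar> powr p / norm h powr M) \<partial>lborel \<partial>lborel)"
    by (rule nn_integral_lborel_swap) measurable
  also have "\<dots> = (\<integral>\<^sup>+w. \<integral>\<^sup>+x. ennreal (gagliardo_kernel s p \<phi> w x) \<partial>lborel \<partial>lborel)"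
  proof (rule nn_integral_cong)
    fix w
    show "(\<integral>\<^sup>+h. ennreal (\<bar>\<phi> (h + w) - \<phi> w\<bar> powr p / norm h powr M) \<partial>lborel) =
      (\<integral>\<^sup>+x. ennreal (gagliardo_kernel s p \<phi> w x) \<partial>lborel)"
      using nn_integral_lborel_translate[of "\<lambda>h. ennreal (\<bar>\<phi> (h + w) - \<phi> w\<bar> powr p / norm h powr M)" w]
      by (simp add: gagliardo_kernel_def M_def norm_minus_commute[of w] abs_minus_commute[of "\<phi> w"])
  qed
  also have "ennreal (R ^ DIM('a)) * (ennreal (R powr - M) * (\<integral>\<^sup>+w. \<integral>\<^sup>+x. ennreal (gagliardo_kernel s p \<phi> w x) \<partial>lborel \<partial>lborel))
     = ennreal (R ^ DIM('a) * R powr - M) * gagliardo_energy s p \<phi>"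
    using R by (simp add: gagliardo_energy_def ennreal_mult mult.assoc)
  also have "R ^ DIM('a) * R powr - M = R powr - (s * p)"
    using R by (simp add: M_def powr_realpow[symmetric] powr_add[symmetric])
  finally show ?thesis by (simp add: M_def)
qed

text \<open>The product rule
  \<open>u x \<eta> x - u y \<eta> y = \<eta> x (u x - u y) + u y (\<eta> x - \<eta> y)\<close> splits the energy of a localised function
  into a part of the energy of \<open>u\<close> and a part of the energy of the cutoff. Integration over all
  positions of the cutoff restores the full integrals of \<open>u\<close> in both parts.\<close>

lemma averaged_localised_energy:
  fixes u \<phi> :: "'a::euclidean_space \<Rightarrow> real"
  assumes u[measurable]: "u \<in> borel_measurable borel" and \<phi>[measurable]: "\<phi> \<in> borel_measurable borel"
    and R: "R > 0" and p: "p > 0"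
  shows "(\<integral>\<^sup>+z. gagliardo_energy s p (\<lambda>x. u x * \<phi> ((1 / R) *\<^sub>R x - z)) \<partial>lborel) \<le>
    ennreal (2 powr p) * ((\<integral>\<^sup>+x. ennreal (\<bar>\<phi> x\<bar> powr p) \<partial>lborel) * gagliardo_energy s p u +
      ennreal (R powr - (s * p)) * gagliardo_energy s p \<phi> * (\<integral>\<^sup>+x. ennreal (\<bar>u x\<bar> powr p) \<partial>lborel))"
proof -
  define M where "M = real DIM('a) + s * p"
  define \<eta> where "\<eta> = (\<lambda>z x. \<phi> ((1 / R) *\<^sub>R x - z))"
  have [measurable]: "(\<lambda>(z, x). \<eta> z x) \<in> borel_measurable (borel \<Otimes>\<^sub>M borel)" unfolding \<eta>_def by measurable
  define a where "a = (\<lambda>z x y. ennreal (\<bar>\<eta> z x\<bar> powr p) * ennreal (gagliardo_kernel s p u x y))"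
  define b where "b = (\<lambda>z x y. ennreal (\<bar>u y\<bar> powr p) * ennreal (\<bar>\<eta> z x - \<eta> z y\<bar> powr p / norm (x - y) powr M))"
  have le: "ennreal (gagliardo_kernel s p (\<lambda>x. u x * \<eta> z x) x y) \<le> ennreal (2 powr p) * (a z x y + b z x y)" for z x y
  proof -
    have "u x * \<eta> z x - u y * \<eta> z y = \<eta> z x * (u x - u y) + u y * (\<eta> z x - \<eta> z y)" by (simp add: algebra_simps)
    then have "\<bar>u x * \<eta> z x - u y * \<eta> z y\<bar> powr p \<le> 2 powr p * (\<bar>\<eta> z x\<bar> powr p * \<bar>u x - u y\<bar> powr p + \<bar>u y\<bar> powr p * \<bar>\<eta> z x - \<eta> z y\<bar> powr p)"
      using abs_add_powr_le[of p "\<eta> z x * (u x - u y)" "u y * (\<eta> z x - \<eta> z y)"] p by (simp add: abs_mult powr_mult)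
    from divide_right_mono[OF this, of "norm (x - y) powr M"]
    have "gagliardo_kernel s p (\<lambda>x. u x * \<eta> z x) x y \<le> 2 powr p * (\<bar>\<eta> z x\<bar> powr p * gagliardo_kernel s p u x y
        + \<bar>u y\<bar> powr p * (\<bar>\<eta> z x - \<eta> z y\<bar> powr p / norm (x - y) powr M))"
      by (simp add: gagliardo_kernel_def M_def add_divide_distrib[symmetric])
    then have "ennreal (gagliardo_kernel s p (\<lambda>x. u x * \<eta> z x) x y) \<le> ennreal (2 powr p * (\<bar>\<eta> z x\<bar> powr p * gagliardo_kernel s p u x y
        + \<bar>u y\<bar> powr p * (\<bar>\<eta> z x - \<eta> z y\<bar> powr p / norm (x - y) powr M)))"
      by (rule ennreal_leI)
    also have "\<dots> = ennreal (2 powr p) * (a z x y + b z x y)"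
      unfolding a_def b_def by (simp only: ennreal_mult ennreal_plus powr_ge_zero gagliardo_kernel_nonneg
          mult_nonneg_nonneg divide_nonneg_nonneg add_nonneg_nonneg)
    finally show ?thesis .
  qed
  have [measurable]: "(\<lambda>(x, y). gagliardo_kernel s p u x y) \<in> borel_measurable (borel \<Otimes>\<^sub>M borel)" by measurable
  have [measurable]: "(\<lambda>(z, x, y). a z x y) \<in> borel_measurable (borel \<Otimes>\<^sub>M borel \<Otimes>\<^sub>M borel)"
    "(\<lambda>(z, x, y). b z x y) \<in> borel_measurable (borel \<Otimes>\<^sub>M borel \<Otimes>\<^sub>M borel)"
    unfolding a_def b_def gagliardo_kernel_def by measurable
  have [measurable]: "(\<lambda>z. \<integral>\<^sup>+x. \<integral>\<^sup>+y. a z x y \<partial>lborel \<partial>lborel) \<in> borel_measurable borel"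
    "(\<lambda>z. \<integral>\<^sup>+x. \<integral>\<^sup>+y. b z x y \<partial>lborel \<partial>lborel) \<in> borel_measurable borel"
    unfolding a_def b_def gagliardo_kernel_def by measurable
  have "(\<integral>\<^sup>+z. gagliardo_energy s p (\<lambda>x. u x * \<eta> z x) \<partial>lborel) \<le>
      (\<integral>\<^sup>+z. \<integral>\<^sup>+x. \<integral>\<^sup>+y. ennreal (2 powr p) * (a z x y + b z x y) \<partial>lborel \<partial>lborel \<partial>lborel)"
    unfolding gagliardo_energy_def by (intro nn_integral_mono le)
  also have "\<dots> = ennreal (2 powr p) *
      ((\<integral>\<^sup>+z. \<integral>\<^sup>+x. \<integral>\<^sup>+y. a z x y \<partial>lborel \<partial>lborel \<partial>lborel) + (\<integral>\<^sup>+z. \<integral>\<^sup>+x. \<integral>\<^sup>+y. b z x y \<partial>lborel \<partial>lborel \<partial>lborel))"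
    by (simp add: nn_integral_cmult nn_integral_add)
  also have "(\<integral>\<^sup>+z. \<integral>\<^sup>+x. \<integral>\<^sup>+y. a z x y \<partial>lborel \<partial>lborel \<partial>lborel) =
      (\<integral>\<^sup>+z. \<integral>\<^sup>+x. ennreal (\<bar>\<phi> ((1 / R) *\<^sub>R x - z)\<bar> powr p) * (\<integral>\<^sup>+y. ennreal (gagliardo_kernel s p u x y) \<partial>lborel) \<partial>lborel \<partial>lborel)"
    unfolding a_def \<eta>_def by (simp add: nn_integral_cmult)
  also have "\<dots> = (\<integral>\<^sup>+x. ennreal (\<bar>\<phi> x\<bar> powr p) \<partial>lborel) * gagliardo_energy s p u"
    unfolding gagliardo_energy_def
    by (rule nn_integral_translated_product[where g = "\<lambda>x. ennreal (\<bar>\<phi> x\<bar> powr p)"]) measurable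
  also have "(\<integral>\<^sup>+z. \<integral>\<^sup>+x. \<integral>\<^sup>+y. b z x y \<partial>lborel \<partial>lborel \<partial>lborel) =
      (\<integral>\<^sup>+z. \<integral>\<^sup>+y. \<integral>\<^sup>+x. b z x y \<partial>lborel \<partial>lborel \<partial>lborel)"
    unfolding b_def by (rule nn_integral_cong, rule nn_integral_lborel_swap) measurable
  also have "\<dots> = (\<integral>\<^sup>+y. \<integral>\<^sup>+z. \<integral>\<^sup>+x. b z x y \<partial>lborel \<partial>lborel \<partial>lborel)"
    unfolding b_def by (rule nn_integral_lborel_swap) measurable
  also have "\<dots> = (\<integral>\<^sup>+y. \<integral>\<^sup>+x. \<integral>\<^sup>+z. b z x y \<partial>lborel \<partial>lborel \<partial>lborel)"
    unfolding b_def by (rule nn_integral_cong, rule nn_integral_lborel_swap) measurable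
  also have "\<dots> = (\<integral>\<^sup>+y. ennreal (\<bar>u y\<bar> powr p) * (\<integral>\<^sup>+x. \<integral>\<^sup>+z. ennreal (\<bar>\<phi> ((1 / R) *\<^sub>R x - z) - \<phi> ((1 / R) *\<^sub>R y - z)\<bar> powr p /
        norm (x - y) powr (real DIM('a) + s * p)) \<partial>lborel \<partial>lborel) \<partial>lborel)"
    unfolding b_def \<eta>_def M_def by (simp add: nn_integral_cmult)
  also have "\<dots> = (\<integral>\<^sup>+y. ennreal (\<bar>u y\<bar> powr p) * (ennreal (R powr - (s * p)) * gagliardo_energy s p \<phi>) \<partial>lborel)"
    by (simp only: averaged_rescaled_energy[OF \<phi> R])
  also have "\<dots> = ennreal (R powr - (s * p)) * gagliardo_energy s p \<phi> * (\<integral>\<^sup>+x. ennreal (\<bar>u x\<bar> powr p) \<partial>lborel)"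
    by (simp add: nn_integral_multc mult.commute)
  finally show ?thesis unfolding \<eta>_def .
qed

text \<open>The hypothesis is applied to \<open>u\<close> times a cutoff of radius \<open>R \<rho>\<close> and converted from \<open>L\<^sup>q\<close> to
  \<open>L\<^sup>p\<close> on the support of the cutoff, at the price of the power \<open>1 - p / q\<close> of the volume;
  afterwards everything is averaged over the position of the cutoff.\<close>

lemma localised_inequality:
  fixes u \<phi> :: "'a::euclidean_space \<Rightarrow> real"
  assumes p: "1 < p" and s: "0 < s" "s < 1" and pq: "p < q"
    and C: "C \<ge> 0" "\<And>v. v \<in> test_functions \<Omega> \<Longrightarrow> Lp_seminorm lborel q v \<le> C * gagliardo s p v"
    and \<phi>: "\<phi> \<in> test_functions \<Omega>" and \<rho>: "\<rho> > 0" "\<And>x. \<phi> x \<noteq> 0 \<Longrightarrow> norm x < \<rho>"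
    and u: "u \<in> test_functions \<Omega>" and R: "R > 0"
  shows "Lp_seminorm lborel p \<phi> powr p * Lp_seminorm lborel p u powr p \<le>
    2 * (unit_ball_vol DIM('a) * \<rho> powr DIM('a)) powr (1 - p / q) * C powr p * 2 powr p *
    R powr (DIM('a) * (1 - p / q)) *
    (Lp_seminorm lborel p \<phi> powr p * gagliardo s p u powr p
      + R powr - (s * p) * gagliardo s p \<phi> powr p * Lp_seminorm lborel p u powr p)"
proof -
  have [measurable]: "u \<in> borel_measurable borel" "\<phi> \<in> borel_measurable borel"
    using u \<phi> by (auto intro: test_function_borel)
  define N where "N = real DIM('a)"
  define w where "w = unit_ball_vol N"
  have w: "w > 0" by (simp add: w_def N_def)
  define V where "V = w * (R * \<rho>) powr N"
  have V: "V > 0" using w R \<rho> by (simp add: V_def)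
  define v where "v = (\<lambda>z x. u x * \<phi> ((1 / R) *\<^sub>R x - z))"
  have v: "v z \<in> test_functions \<Omega>" for z
    using test_functions_mult_rescaled[OF u \<phi>, of "1 / R" "- z"] by (simp add: v_def)
  define K where "K = 2 * V powr (1 - p / q) * C powr p"
  have K: "K \<ge> 0" by (simp add: K_def)
  have loc: "(\<integral>\<^sup>+x. ennreal (\<bar>v z x\<bar> powr p) \<partial>lborel) \<le> ennreal K * gagliardo_energy s p (v z)" for z
  proof -
    have supp: "x \<in> ball (R *\<^sub>R z) (R * \<rho>)" if "v z x \<noteq> 0" for x
    proof -
      have "norm ((1 / R) *\<^sub>R x - z) < \<rho>" using that by (intro \<rho>) (auto simp: v_def)
      then have "R * norm ((1 / R) *\<^sub>R x - z) < R * \<rho>" using R by simp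
      also have "R * norm ((1 / R) *\<^sub>R x - z) = norm (R *\<^sub>R ((1 / R) *\<^sub>R x - z))" using R by simp
      also have "R *\<^sub>R ((1 / R) *\<^sub>R x - z) = x - R *\<^sub>R z" using R by (simp add: scaleR_diff_right)
      finally show ?thesis by (simp add: dist_norm norm_minus_commute)
    qed
    have vol: "emeasure lborel (ball (R *\<^sub>R z) (R * \<rho>)) \<le> ennreal V"
      using R \<rho> by (subst emeasure_ball) (auto simp: V_def w_def N_def powr_realpow)
    have "Lp_seminorm lborel p (v z) powr p \<le> 2 * V powr (1 - p / q) * Lp_seminorm lborel q (v z) powr p"
      using p pq V supp vol by (intro Lp_seminorm_le_on_support[OF v, where B = "ball (R *\<^sub>R z) (R * \<rho>)"]) auto
    also have "\<dots> \<le> 2 * V powr (1 - p / q) * (C * gagliardo s p (v z)) powr p"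
      using p C(2)[OF v] by (intro mult_left_mono powr_mono2) auto
    also have "\<dots> = K * gagliardo s p (v z) powr p"
      using C by (simp add: K_def powr_mult)
    finally show ?thesis
      using p K by (simp add: nn_integral_test_function[OF v] gagliardo_energy_eq[OF v p s] ennreal_mult[symmetric])
  qed
  have [measurable]: "(\<lambda>(z, x). v z x) \<in> borel_measurable (borel \<Otimes>\<^sub>M borel)" unfolding v_def by measurable
  define P where "P = Lp_seminorm lborel p u powr p"
  define F where "F = Lp_seminorm lborel p \<phi> powr p"
  have PF: "(\<integral>\<^sup>+x. ennreal (\<bar>u x\<bar> powr p) \<partial>lborel) = ennreal P" "(\<integral>\<^sup>+x. ennreal (\<bar>\<phi> x\<bar> powr p) \<partial>lborel) = ennreal F"
    "P \<ge> 0" "F \<ge> 0"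
    using p by (auto simp: P_def F_def nn_integral_test_function[OF u] nn_integral_test_function[OF \<phi>])
  have "ennreal (F * P) = (\<integral>\<^sup>+z. \<integral>\<^sup>+x. ennreal (\<bar>\<phi> ((1 / R) *\<^sub>R x - z)\<bar> powr p) * ennreal (\<bar>u x\<bar> powr p) \<partial>lborel \<partial>lborel)"
    using nn_integral_translated_product[of "\<lambda>x. ennreal (\<bar>u x\<bar> powr p)" "\<lambda>x. ennreal (\<bar>\<phi> x\<bar> powr p)" "1 / R"] PF
    by (simp add: ennreal_mult)
  also have "\<dots> = (\<integral>\<^sup>+z. \<integral>\<^sup>+x. ennreal (\<bar>v z x\<bar> powr p) \<partial>lborel \<partial>lborel)"
    by (simp add: v_def abs_mult powr_mult ennreal_mult[symmetric] mult.commute)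
  also have "\<dots> \<le> (\<integral>\<^sup>+z. ennreal K * gagliardo_energy s p (v z) \<partial>lborel)"
    by (intro nn_integral_mono loc)
  also have "\<dots> = ennreal K * (\<integral>\<^sup>+z. gagliardo_energy s p (v z) \<partial>lborel)"
    unfolding gagliardo_energy_def gagliardo_kernel_def by (intro nn_integral_cmult) measurable
  also have "\<dots> \<le> ennreal K * (ennreal (2 powr p) * (ennreal F * gagliardo_energy s p u +
      ennreal (R powr - (s * p)) * gagliardo_energy s p \<phi> * ennreal P))"
    unfolding v_def PF(1,2)[symmetric] using R p by (intro mult_left_mono averaged_localised_energy) auto
  also have "\<dots> = ennreal (K * (2 powr p * (F * gagliardo s p u powr p + R powr - (s * p) * gagliardo s p \<phi> powr p * P)))"
    unfolding gagliardo_energy_eq[OF u p s] gagliardo_energy_eq[OF \<phi> p s] using PF K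
    by (simp add: ennreal_mult ennreal_plus)
  finally have "F * P \<le> K * (2 powr p * (F * gagliardo s p u powr p + R powr - (s * p) * gagliardo s p \<phi> powr p * P))"
    using PF K by (subst (asm) ennreal_le_iff) auto
  also have "V powr (1 - p / q) = (w * \<rho> powr N) powr (1 - p / q) * R powr (N * (1 - p / q))"
    using R \<rho> by (simp add: V_def powr_mult powr_powr)
  then have "K * (2 powr p * (F * gagliardo s p u powr p + R powr - (s * p) * gagliardo s p \<phi> powr p * P)) =
     2 * (w * \<rho> powr N) powr (1 - p / q) * C powr p * 2 powr p * R powr (N * (1 - p / q)) *
     (F * gagliardo s p u powr p + R powr - (s * p) * gagliardo s p \<phi> powr p * P)"
    by (simp add: K_def)
  finally show ?thesis unfolding F_def P_def w_def N_def .
qed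

text \<open>Subcriticality in the form in which it is used: the volume factor \<open>R powr (N (1 - p / q))\<close> grows more
  slowly than the averaged energy of a cutoff at scale \<open>R\<close> decays.\<close>

lemma subcritical_exponent_gap:
  assumes p: "1 < p" and s: "0 < s" and pq: "p < q" and q: "ereal q < critical_exponent N s p"
  shows "real N * (1 - p / q) < s * p"
proof (cases "s * p < real N")
  case True
  then have "q < real N * p / (real N - s * p)" using q by (simp add: critical_exponent_def)
  then have "q * (real N - s * p) < real N * p" using True by (simp add: field_simps)
  then show ?thesis using p pq by (simp add: field_simps)
next
  case False
  have "real N * (1 - p / q) \<le> s * p * (1 - p / q)"
    using False p pq by (intro mult_right_mono) auto
  also have "\<dots> < s * p * 1" using p s pq by (intro mult_strict_left_mono) auto
  finally show ?thesis by simp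
qed

text \<open>By the gap between the exponents, the term of the localised inequality that contains
  \<open>\<parallel>u\<parallel>\<^sub>p\<close> on the right has a coefficient that tends to \<open>0\<close> as \<open>R\<close> grows; a fixed large \<open>R\<close>
  makes it at most half of the left-hand side, so that it can be absorbed. If there is no test
  function to serve as cutoff, the bound to be proved is trivial.\<close>

lemma energy_bounds_Lp_back:
  fixes \<Omega> :: "'a::euclidean_space set"
  assumes p: "1 < p" and s: "0 < s" "s < 1" and q: "p < q" "ereal q < critical_exponent DIM('a) s p"
    and E: "energy_bounds_Lp s p q \<Omega>"
  shows "energy_bounds_Lp s p p \<Omega>"
proof (cases "\<forall>\<phi>\<in>test_functions \<Omega>. Lp_seminorm lborel p \<phi> = 0")
  case True
  then show ?thesis unfolding energy_bounds_Lp_def by (intro exI[of _ 0]) simp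
next
  case False
  then obtain \<phi> where \<phi>: "\<phi> \<in> test_functions \<Omega>" "Lp_seminorm lborel p \<phi> \<noteq> 0" by blast
  obtain \<rho> where \<rho>: "\<rho> > 0" "\<And>x. \<phi> x \<noteq> 0 \<Longrightarrow> norm x < \<rho>"
    using test_function_bounded_support[OF \<phi>(1)] by blast
  obtain C where C: "C \<ge> 0" "\<And>u. u \<in> test_functions \<Omega> \<Longrightarrow> Lp_seminorm lborel q u \<le> C * gagliardo s p u"
    using energy_bounds_Lp_nonneg[OF E] by blast
  define F where "F = Lp_seminorm lborel p \<phi> powr p"
  have F: "F > 0" using \<phi>(2) by (simp add: F_def)
  define G where "G = gagliardo s p \<phi> powr p"
  have G: "G \<ge> 0" by (simp add: G_def)
  define K where "K = 2 * (unit_ball_vol DIM('a) * \<rho> powr DIM('a)) powr (1 - p / q) * C powr p * 2 powr p"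
  have K: "K \<ge> 0" by (simp add: K_def)
  define \<alpha> where "\<alpha> = real DIM('a) * (1 - p / q)"
  define \<delta> where "\<delta> = s * p - \<alpha>"
  have \<delta>: "\<delta> > 0" using subcritical_exponent_gap[OF p s(1) q] by (simp add: \<delta>_def \<alpha>_def)
  \<comment> \<open>Chosen so that \<open>R powr \<delta> = X\<close> and \<open>K * G / X \<le> F / 2\<close>; the summand \<open>1\<close> keeps \<open>X\<close> positive
    when \<open>K * G = 0\<close>.\<close>
  define X where "X = 2 * K * G / F + 1"
  have X: "X > 0" unfolding X_def using K G F by (intro add_nonneg_pos) auto
  define R where "R = X powr (1 / \<delta>)"
  have R: "R > 0" "R powr \<delta> = X" using X \<delta> by (auto simp: R_def powr_powr)
  have absorb: "K * R powr \<alpha> * (R powr - (s * p) * G) \<le> F / 2"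
  proof -
    have "R powr \<alpha> * R powr - (s * p) = 1 / X"
      using R by (simp add: powr_add[symmetric] powr_minus_divide[symmetric] \<delta>_def flip: R(2))
    then have "K * R powr \<alpha> * (R powr - (s * p) * G) = K * G / X"
      by (simp add: mult.assoc[symmetric]) (simp add: mult.assoc)
    also have "\<dots> \<le> F / 2" using X F K G by (simp add: X_def field_simps)
    finally show ?thesis .
  qed
  define D where "D = 2 * K * R powr \<alpha>"
  have D: "D \<ge> 0" using K by (simp add: D_def)
  have "Lp_seminorm lborel p u \<le> D powr (1 / p) * gagliardo s p u" if u: "u \<in> test_functions \<Omega>" for u
  proof -
    define P where "P = Lp_seminorm lborel p u powr p"
    define g where "g = gagliardo s p u powr p"
    have P: "P \<ge> 0" by (simp add: P_def)
    have "F * P \<le> K * R powr \<alpha> * (F * g + R powr - (s * p) * G * P)"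
      using localised_inequality[OF p s q(1) C \<phi>(1) \<rho> u R(1)]
      by (simp add: F_def P_def K_def \<alpha>_def g_def G_def)
    also have "\<dots> = K * R powr \<alpha> * F * g + K * R powr \<alpha> * (R powr - (s * p) * G) * P"
      by (simp add: algebra_simps)
    also have "\<dots> \<le> K * R powr \<alpha> * F * g + F / 2 * P"
      by (intro add_left_mono mult_right_mono absorb P)
    finally have "F * P \<le> F * (D * g)" by (simp add: D_def algebra_simps)
    then have "P \<le> D * g" using F by simp
    also have "\<dots> = (D powr (1 / p) * gagliardo s p u) powr p"
      using D p by (simp add: g_def powr_mult powr_powr)
    finally show ?thesis
      using p by (subst Lp_seminorm_le_iff) (auto simp: P_def integral_eq_Lp_seminorm_powr)
  qed
  then show ?thesis unfolding energy_bounds_Lp_def by blast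
qed

lemma exponent_below_critical:
  assumes p: "1 < p" and s: "0 < s" and N: "N > 0"
  shows "\<exists>q. p < q \<and> ereal q < critical_exponent N s p"
proof -
  have "ereal p < critical_exponent N s p"
  proof (cases "s * p < real N")
    case True
    have "p * (real N - s * p) < real N * p" using p s by (simp add: algebra_simps)
    then show ?thesis using True by (simp add: critical_exponent_def field_simps)
  qed (simp add: critical_exponent_def)
  then obtain q where "p < q" "ereal q < critical_exponent N s p"
    using ereal_dense2 by (metis ereal_less_ereal_Ex less_ereal.simps(1))
  then show ?thesis by blast
qed

section \<open>Equivalence of the embeddings\<close>

theorem corollary1p2:
  fixes \<Omega> :: "'a::euclidean_space set" and s p :: real
  assumes "1 < p" and "0 < s" and "s < 1" and "open \<Omega>"
  shows "(continuously_embedded s p p \<Omega> \<longleftrightarrow>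
           (\<exists>q::real. p < q \<and> ereal q < critical_exponent DIM('a) s p \<and>
             continuously_embedded s p q \<Omega>)) \<and>
         (continuously_embedded s p p \<Omega> \<longleftrightarrow>
           (\<forall>q::real. p < q \<and> ereal q < critical_exponent DIM('a) s p \<longrightarrow>
             continuously_embedded s p q \<Omega>))"
proof -
  have iff: "continuously_embedded s p q \<Omega> \<longleftrightarrow> energy_bounds_Lp s p q \<Omega>" if "q \<ge> p" for q
    using assms that by (intro continuously_embedded_iff_energy_bounds_Lp) auto
  have up: "energy_bounds_Lp s p q \<Omega>"
    if "p < q" "ereal q < critical_exponent DIM('a) s p" "energy_bounds_Lp s p p \<Omega>" for q
    by (rule energy_bounds_Lp_subcritical[OF assms(1-3) that])
  have down: "energy_bounds_Lp s p p \<Omega>"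
    if "p < q" "ereal q < critical_exponent DIM('a) s p" "energy_bounds_Lp s p q \<Omega>" for q
    by (rule energy_bounds_Lp_back[OF assms(1-3) that])
  have subcritical_iff: "continuously_embedded s p p \<Omega> \<longleftrightarrow> continuously_embedded s p q \<Omega>"
    if "p < q" "ereal q < critical_exponent DIM('a) s p" for q
    unfolding iff[OF order_refl] iff[OF less_imp_le[OF that(1)]]
    using up[OF that] down[OF that] by (rule iffI)
  \<comment> \<open>The range of \<open>q\<close> is nonempty: over an empty range the universal form would hold vacuously and the
    existential form would fail.\<close>
  obtain q where "p < q" "ereal q < critical_exponent DIM('a) s p"
    using exponent_below_critical[of p s "DIM('a)"] assms by auto
  then show ?thesis
    using subcritical_iff by blast
qed

end
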